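(* Fix an integer $n>2$. For $b\in\mathbb{Z}$ let $f_b(x)=x^n+bx+b$ and let $\theta_b$ be a root of $f_b$. Then there are infinitely many integers $b$ such that $f_b$ is irreducible and $\mathbb{Z}[\theta_b]$ is the full ring of integers of $\mathbb{Q}(\theta_b)$. Moreover, the natural density of the set of such $b$ is at least \[\frac{6}{\pi^2}-\left(1-\frac{6}{\pi^2}\prod_{p\mid (n-1)}\left(1-\frac{1}{p^2}\right)^{-1}\right)>21.58\%,\] where the product runs over primes $p$ dividing $n-1$.
   Context: For a set $A$ of integers, its natural density is $\lim_{x\to\infty}\#\{a\in A: a\le x\}/x$ (taken over the relevant counting of integers); "density at least $\alpha$" means this proportion is asymptotically at least $\alpha$. *)

theory Defs
  imports "HOL-Analysis.Analysis" "HOL-Computational_Algebra.Computational_Algebra"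
begin

definition trinom :: "nat \<Rightarrow> int \<Rightarrow> int poly" where
  "trinom n b = monom 1 n + [:b, b:]"

definition algebraic_integer :: "complex \<Rightarrow> bool" where
  "algebraic_integer z \<longleftrightarrow>
     (\<exists>p :: int poly. lead_coeff p = 1 \<and> poly (map_poly of_int p) z = 0)"

definition int_adjoin :: "complex \<Rightarrow> complex set" where
  "int_adjoin \<theta> = {poly (map_poly of_int p) \<theta> | p :: int poly. True}"

text \<open>The field Q(theta); for algebraic theta this equals Q[theta].\<close>
definition rat_adjoin :: "complex \<Rightarrow> complex set" where
  "rat_adjoin \<theta> = {poly (map_poly of_rat p) \<theta> | p :: rat poly. True}"

definition ring_of_integers :: "complex \<Rightarrow> complex set" where
  "ring_of_integers \<theta> = {z \<in> rat_adjoin \<theta>. algebraic_integer z}"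

definition monogenic_by :: "complex \<Rightarrow> bool" where
  "monogenic_by \<theta> \<longleftrightarrow> int_adjoin \<theta> = ring_of_integers \<theta>"

definition lower_density :: "int set \<Rightarrow> ereal" where
  "lower_density A = liminf (\<lambda>N::nat. ereal (real (card {b \<in> A. 1 \<le> b \<and> b \<le> int N}) / real N))"

end

theory Submission
  imports Defs "Jordan_Normal_Form.Char_Poly" "HOL-Computational_Algebra.Field_as_Ring"
    "HOL-Number_Theory.Cong" "HOL-Real_Asymp.Real_Asymp"
begin

text \<open>
  Write \<open>f = x^n + b x + b\<close>, whose discriminant is \<open>\<plusminus> b^(n-1) D\<close> with \<open>D = (-n)^n - b (n-1)^(n-1)\<close>. If
  \<open>b \<ge> 2\<close> and \<open>D\<close> have no square prime divisor, then \<open>f\<close> is Eisenstein at every prime dividing \<open>b\<close>, so it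
  is irreducible and no such prime divides the index of \<open>\<int>[\<theta>]\<close> in the ring of integers. For a prime \<open>p\<close>
  not dividing \<open>b\<close>, an integral element \<open>w\<close> of \<open>p\<inverse>\<int>[\<theta>]\<close> satisfies \<open>f'(\<theta>) w \<in> \<int>[\<theta>]\<close>, hence
  \<open>\<lambda> w \<in> \<int>[\<theta>]\<close> for \<open>\<lambda> = (n-1) \<theta> + n\<close>; the relation \<open>D (1 - \<lambda>) + \<lambda>\<^sup>2 K(\<lambda>) = 0\<close> with \<open>K\<close> monic of
  degree \<open>n - 2\<close> then forces \<open>w \<in> \<int>[\<theta>]\<close>.

  Both \<open>b\<close> and \<open>D\<close> are of the form \<open>c + m b\<close> with \<open>c\<close>, \<open>m\<close> coprime, and the values of such a form without
  square prime divisors have lower density at least the product of \<open>1 - p\<^sup>-\<^sup>2\<close> over the primes \<open>p\<close> not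
  dividing \<open>m\<close>. The two exceptional sets are combined by the union bound.
\<close>

section \<open>The ring of algebraic integers\<close>

definition int_span :: "nat \<Rightarrow> (nat \<Rightarrow> complex) \<Rightarrow> complex set" where
  "int_span k v = {\<Sum>j<k. of_int (c j) * v j | c. True}"

lemma int_span_base: "i < k \<Longrightarrow> v i \<in> int_span k v"
  unfolding int_span_def
  by (rule CollectI, rule exI[of _ "\<lambda>j. if j = i then 1 else 0"])
     (simp add: if_distrib if_distribR sum.delta cong: if_cong)

lemma int_span_zero: "0 \<in> int_span k v"
  unfolding int_span_def by (rule CollectI, rule exI[of _ "\<lambda>j. 0"]) simp

lemma int_span_add:
  assumes "a \<in> int_span k v" "b \<in> int_span k v"
  shows "a + b \<in> int_span k v"
proof -
  from assms obtain c d where "a = (\<Sum>j<k. of_int (c j) * v j)" "b = (\<Sum>j<k. of_int (d j) * v j)"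
    by (auto simp: int_span_def)
  then have "a + b = (\<Sum>j<k. of_int (c j + d j) * v j)"
    by (simp add: sum.distrib ring_distribs)
  then show ?thesis by (auto simp: int_span_def intro!: exI[of _ "\<lambda>j. c j + d j"])
qed

lemma int_span_scale:
  assumes "a \<in> int_span k v"
  shows "of_int m * a \<in> int_span k v"
proof -
  from assms obtain c where "a = (\<Sum>j<k. of_int (c j) * v j)"
    by (auto simp: int_span_def)
  then have "of_int m * a = (\<Sum>j<k. of_int (m * c j) * v j)"
    by (simp add: sum_distrib_left mult.assoc)
  then show ?thesis by (auto simp: int_span_def intro!: exI[of _ "\<lambda>j. m * c j"])
qed

lemma int_span_sum:
  assumes "\<And>i. i \<in> I \<Longrightarrow> a i \<in> int_span k v"
  shows "(\<Sum>i\<in>I. a i) \<in> int_span k v"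
  using assms by (induction I rule: infinite_finite_induct) (auto intro: int_span_zero int_span_add)

lemma int_span_mult_closed:
  assumes "\<And>i. i < k \<Longrightarrow> z * v i \<in> int_span k v" "a \<in> int_span k v"
  shows "z * a \<in> int_span k v"
proof -
  from assms obtain c where c: "a = (\<Sum>j<k. of_int (c j) * v j)"
    by (auto simp: int_span_def)
  have "z * a = (\<Sum>j<k. of_int (c j) * (z * v j))"
    unfolding c by (simp add: sum_distrib_left mult_ac)
  also have "\<dots> \<in> int_span k v"
    by (intro int_span_sum int_span_scale assms) simp
  finally show ?thesis .
qed

text \<open>Multiplication by \<open>z\<close> acts on the generators through an integer matrix, and
  the vector of generators is an eigenvector, nonzero because of \<open>i0\<close>. So
  \<open>z\<close> is a root of the characteristic polynomial, which is monic with integer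
  coefficients.\<close>

lemma algebraic_int_if_stabilizes_int_span:
  assumes stab: "\<And>i. i < k \<Longrightarrow> z * v i \<in> int_span k v" and i0: "i0 < k" "v i0 \<noteq> 0"
  shows "algebraic_int z"
proof -
  have "\<forall>i\<in>{..<k}. \<exists>c. z * v i = (\<Sum>j<k. of_int (c j) * v j)"
    using stab by (auto simp: int_span_def)
  then obtain C where C: "\<And>i. i < k \<Longrightarrow> z * v i = (\<Sum>j<k. of_int (C i j) * v j)"
    by (metis bchoice lessThan_iff)
  define A :: "int mat" where "A = Matrix.mat k k (\<lambda>(i, j). C i j)"
  define w where "w = Matrix.vec k v"
  let ?B = "map_mat of_int A :: complex mat"
  have A: "A \<in> carrier_mat k k" and B: "?B \<in> carrier_mat k k"
    by (auto simp: A_def)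
  have "?B *\<^sub>v w = z \<cdot>\<^sub>v w"
    by (rule eq_vecI) (auto simp: A_def w_def C scalar_prod_def atLeast0LessThan)
  moreover have "w \<noteq> 0\<^sub>v k"
    using i0 by (metis index_vec index_zero_vec(1) w_def)
  ultimately have "eigenvalue ?B z"
    unfolding eigenvalue_def eigenvector_def using B by (auto simp: w_def intro!: exI[of _ w])
  then have "poly (char_poly ?B) z = 0"
    using eigenvalue_root_char_poly[OF B] by simp
  moreover have "char_poly ?B = map_poly of_int (char_poly A)"
    using of_int_hom.char_poly_hom[OF A] by simp
  moreover have "lead_coeff (char_poly A) = 1"
    using degree_monic_char_poly[OF A] by simp
  ultimately show ?thesis
    unfolding algebraic_int_altdef_ipoly by metis
qed

text \<open>The products \<open>x ^ i * y ^ j\<close> with exponents below the degrees of monic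
  equations for \<open>x\<close> and \<open>y\<close> span a group that both numbers stabilize,
  since the first power out of range is an integer combination of lower ones. The group is then
  stable under the sum and the product as well.\<close>

lemma algebraic_int_ring:
  assumes "algebraic_int (x :: complex)" "algebraic_int y"
  shows algebraic_int_add: "algebraic_int (x + y)" and algebraic_int_mult: "algebraic_int (x * y)"
proof -
  obtain p q where p: "poly (map_poly of_int p) x = 0" "lead_coeff p = 1"
    and q: "poly (map_poly of_int q) y = 0" "lead_coeff q = 1"
    using assms unfolding algebraic_int_altdef_ipoly by metis
  define d e where "d = degree p" and "e = degree q"
  have "d > 0"
  proof (rule ccontr)
    assume "\<not> d > 0"
    then obtain a where "p = [:a:]" unfolding d_def by (metis degree_eq_zeroE neq0_conv)
    with p show False by simp
  qed
  have "e > 0"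
  proof (rule ccontr)
    assume "\<not> e > 0"
    then obtain a where "q = [:a:]" unfolding e_def by (metis degree_eq_zeroE neq0_conv)
    with q show False by simp
  qed
  \<comment> \<open>The index \<open>k\<close> encodes the exponent pair \<open>(i, j)\<close> as
    \<open>k = i * e + j\<close>.\<close>
  define v where "v = (\<lambda>k. x ^ (k div e) * y ^ (k mod e))"
  let ?M = "int_span (d * e) v"
  have gen: "x ^ i * y ^ j \<in> ?M" if "i < d" "j < e" for i j
  proof -
    have "i * e + j < d * e"
    proof -
      have "i * e + j < (i + 1) * e" using that by simp
      also have "\<dots> \<le> d * e" using that by (intro mult_right_mono) auto
      finally show ?thesis .
    qed
    moreover have "v (i * e + j) = x ^ i * y ^ j"
      using that by (simp add: v_def)
    ultimately show ?thesis using int_span_base[of "i * e + j" "d * e" v] by simp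
  qed
  have top: "z ^ degree r = (\<Sum>i<degree r. of_int (- coeff r i) * z ^ i)"
    if "poly (map_poly of_int r) z = 0" "lead_coeff r = 1" for r and z :: complex
  proof -
    have "0 = (\<Sum>i\<le>degree r. of_int (coeff r i) * z ^ i)"
      using that(1) by (simp add: poly_altdef coeff_map_poly)
    also have "\<dots> = z ^ degree r + (\<Sum>i<degree r. of_int (coeff r i) * z ^ i)"
      using that(2) by (simp add: lessThan_Suc_atMost[symmetric])
    finally have "z ^ degree r = - (\<Sum>i<degree r. of_int (coeff r i) * z ^ i)"
      by (metis add.commute eq_neg_iff_add_eq_0)
    then show ?thesis by (simp add: sum_negf)
  qed
  have dm: "i div e < d" "i mod e < e" if "i < d * e" for i
    using that \<open>e > 0\<close> by (auto simp: less_mult_imp_div_less)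
  have x: "x * v i \<in> ?M" if "i < d * e" for i
  proof (cases "Suc (i div e) < d")
    case True
    have "x * v i = x ^ Suc (i div e) * y ^ (i mod e)" by (simp add: v_def)
    with gen[OF True dm(2)[OF that]] show ?thesis by metis
  next
    case False
    then have "Suc (i div e) = d" using dm(1)[OF that] by simp
    then have "x * v i = x ^ d * y ^ (i mod e)" by (auto simp: v_def mult_ac)
    also have "\<dots> = (\<Sum>l<d. of_int (- coeff p l) * (x ^ l * y ^ (i mod e)))"
      unfolding d_def top[OF p] sum_distrib_right by (simp add: mult_ac)
    also have "\<dots> \<in> ?M"
      by (intro int_span_sum int_span_scale gen dm that) auto
    finally show ?thesis .
  qed
  have y: "y * v i \<in> ?M" if "i < d * e" for i
  proof (cases "Suc (i mod e) < e")
    case True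
    have "y * v i = x ^ (i div e) * y ^ Suc (i mod e)" by (simp add: v_def)
    with gen[OF dm(1)[OF that] True] show ?thesis by metis
  next
    case False
    then have "Suc (i mod e) = e" using dm(2)[OF that] by simp
    then have "y * v i = x ^ (i div e) * y ^ e" by (metis mult.assoc mult.commute power_Suc v_def)
    also have "\<dots> = (\<Sum>l<e. of_int (- coeff q l) * (x ^ (i div e) * y ^ l))"
      unfolding e_def top[OF q] sum_distrib_left by (simp add: mult_ac)
    also have "\<dots> \<in> ?M"
      by (intro int_span_sum int_span_scale gen dm that) auto
    finally show ?thesis .
  qed
  have one: "0 < d * e" "v 0 \<noteq> 0" using \<open>d > 0\<close> \<open>e > 0\<close> by (auto simp: v_def)
  show "algebraic_int (x + y)"
    by (rule algebraic_int_if_stabilizes_int_span[where v = v, OF _ one])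
       (simp add: distrib_right int_span_add x y)
  show "algebraic_int (x * y)"
    by (rule algebraic_int_if_stabilizes_int_span[where v = v, OF _ one])
       (simp add: mult.assoc int_span_mult_closed x y)
qed

section \<open>Closure properties of algebraic integers\<close>

lemma algebraic_integer_iff: "algebraic_integer z \<longleftrightarrow> algebraic_int z"
  unfolding algebraic_integer_def algebraic_int_altdef_ipoly by metis

lemma algebraic_int_diff: "algebraic_int (x :: complex) \<Longrightarrow> algebraic_int y \<Longrightarrow> algebraic_int (x - y)"
  using algebraic_int_add[of x "- y"] by simp

lemma algebraic_int_int: "algebraic_int (of_int k :: complex)"
  by (rule int_imp_algebraic_int) simp

lemma algebraic_int_one: "algebraic_int (1 :: complex)"
  using algebraic_int_int[of 1] by simp

lemma algebraic_int_pow: "algebraic_int (x :: complex) \<Longrightarrow> algebraic_int (x ^ k)"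
  by (induction k) (auto intro: algebraic_int_one algebraic_int_mult)

lemma algebraic_int_sum:
  "(\<And>i. i \<in> I \<Longrightarrow> algebraic_int (a i :: complex)) \<Longrightarrow> algebraic_int (sum a I)"
  by (induction I rule: infinite_finite_induct) (auto intro: algebraic_int_add)

lemma ipoly_pCons:
  "poly (map_poly of_int (pCons a p)) (x :: complex) = of_int a + x * poly (map_poly of_int p) x"
  by (subst of_int_hom.map_poly_pCons_hom) simp

lemma algebraic_int_ipoly:
  assumes "algebraic_int (x :: complex)"
  shows "algebraic_int (poly (map_poly of_int p) x)"
proof (induction p)
  case 0
  then show ?case by simp
next
  case (pCons a p)
  then show ?case by (simp add: ipoly_pCons assms algebraic_int_add algebraic_int_int algebraic_int_mult)
qed

lemma algebraic_int_coeff_mult: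
  assumes "\<And>i. algebraic_int (coeff p i :: complex)" "\<And>i. algebraic_int (coeff q i)"
  shows "algebraic_int (coeff (p * q) i)"
  unfolding coeff_mult by (intro algebraic_int_sum algebraic_int_mult assms)

lemma algebraic_int_coeff_prod:
  assumes "\<And>x j. x \<in> X \<Longrightarrow> algebraic_int (coeff (F x) j :: complex)"
  shows "algebraic_int (coeff (\<Prod>x\<in>X. F x) i)"
  using assms
proof (induction X arbitrary: i rule: infinite_finite_induct)
  case (insert x X)
  then show ?case by (simp add: algebraic_int_coeff_mult)
qed (auto simp: coeff_1 algebraic_int_one)

lemma algebraic_int_rat_imp_Ints:
  assumes "algebraic_int (of_rat q :: complex)"
  shows "q \<in> \<int>"
proof -
  have "(of_rat q :: complex) \<in> \<int>"
    using rational_algebraic_int_is_int[OF assms] by simp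
  then obtain k where "(of_rat q :: complex) = of_rat (of_int k)"
    by (auto elim: Ints_cases)
  then show ?thesis by (simp only: of_rat_eq_iff Ints_of_int)
qed

text \<open>The integers are integrally closed. This turns integrality back into
  divisibility.\<close>

lemma algebraic_int_div_imp_dvd:
  assumes "algebraic_int (of_int c / of_int p :: complex)" "p \<noteq> 0"
  shows "p dvd c"
proof -
  have "of_rat (of_int c / of_int p) = (of_int c / of_int p :: complex)"
    by (simp add: of_rat_divide)
  with assms(1) have "(of_int c / of_int p :: rat) \<in> \<int>"
    by (metis algebraic_int_rat_imp_Ints)
  then obtain k where "(of_int c / of_int p :: rat) = of_int k" by (auto elim: Ints_cases)
  with \<open>p \<noteq> 0\<close> have "(of_int c :: rat) = of_int (k * p)" by (simp add: field_simps)
  then show ?thesis by (simp only: of_int_eq_iff) simp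
qed

section \<open>Integral elements of \<open>\<rat>(\<theta>)\<close>\<close>

lemma int_adjoin_ipoly: "poly (map_poly of_int p) \<theta> \<in> int_adjoin \<theta>"
  by (auto simp: int_adjoin_def)

lemma int_adjoin_int: "of_int k \<in> int_adjoin \<theta>"
  using int_adjoin_ipoly[of "[:k:]" \<theta>] by (simp only: ipoly_pCons) simp

lemma int_adjoin_gen: "\<theta> \<in> int_adjoin \<theta>"
  using int_adjoin_ipoly[of "[:0, 1:]" \<theta>] by simp

lemma int_adjoin_add: "x \<in> int_adjoin \<theta> \<Longrightarrow> y \<in> int_adjoin \<theta> \<Longrightarrow> x + y \<in> int_adjoin \<theta>"
proof -
  assume "x \<in> int_adjoin \<theta>" "y \<in> int_adjoin \<theta>"
  then obtain p q where "x = poly (map_poly of_int p) \<theta>" "y = poly (map_poly of_int q) \<theta>"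
    by (auto simp: int_adjoin_def)
  then show ?thesis using int_adjoin_ipoly[of "p + q" \<theta>] by (simp add: of_int_poly_hom.hom_add)
qed

lemma int_adjoin_mult: "x \<in> int_adjoin \<theta> \<Longrightarrow> y \<in> int_adjoin \<theta> \<Longrightarrow> x * y \<in> int_adjoin \<theta>"
proof -
  assume "x \<in> int_adjoin \<theta>" "y \<in> int_adjoin \<theta>"
  then obtain p q where "x = poly (map_poly of_int p) \<theta>" "y = poly (map_poly of_int q) \<theta>"
    by (auto simp: int_adjoin_def)
  then show ?thesis using int_adjoin_ipoly[of "p * q" \<theta>] by (simp add: of_int_poly_hom.hom_mult)
qed

lemma int_adjoin_uminus: "x \<in> int_adjoin \<theta> \<Longrightarrow> - x \<in> int_adjoin \<theta>"
  using int_adjoin_mult[OF int_adjoin_int[of "- 1"]] by simp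

lemma int_adjoin_diff: "x \<in> int_adjoin \<theta> \<Longrightarrow> y \<in> int_adjoin \<theta> \<Longrightarrow> x - y \<in> int_adjoin \<theta>"
  using int_adjoin_add[OF _ int_adjoin_uminus] by force

lemma int_adjoin_pow: "x \<in> int_adjoin \<theta> \<Longrightarrow> x ^ k \<in> int_adjoin \<theta>"
  using int_adjoin_int[of 1] by (induction k) (auto intro: int_adjoin_mult)

lemma int_adjoin_sum:
  "(\<And>i. i \<in> I \<Longrightarrow> a i \<in> int_adjoin \<theta>) \<Longrightarrow> sum a I \<in> int_adjoin \<theta>"
  using int_adjoin_int[of 0] by (induction I rule: infinite_finite_induct) (auto intro: int_adjoin_add)

lemma int_adjoin_imp_algebraic_int:
  "algebraic_int \<theta> \<Longrightarrow> x \<in> int_adjoin \<theta> \<Longrightarrow> algebraic_int x"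
  by (auto simp: int_adjoin_def intro: algebraic_int_ipoly)

text \<open>If \<open>u * c + v * p = 1\<close>, then \<open>x / p\<close> is \<open>u\<close> times
  \<open>c * x / p\<close> plus \<open>v * x\<close>. The set \<open>R\<close> is kept general to
  serve both the algebraic integers and \<open>int_adjoin \<theta>\<close>.\<close>

lemma coprime_divide_closed:
  fixes R :: "complex set" and c p :: int
  assumes add: "\<And>a b. a \<in> R \<Longrightarrow> b \<in> R \<Longrightarrow> a + b \<in> R"
    and scale: "\<And>a k. a \<in> R \<Longrightarrow> of_int k * a \<in> R"
    and "coprime c p" "p \<noteq> 0" "x \<in> R" "of_int c * x / of_int p \<in> R"
  shows "x / of_int p \<in> R"
proof -
  obtain u v where "u * c + v * p = 1"
    using \<open>coprime c p\<close> by (metis bezout_int coprime_iff_gcd_eq_1)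
  then have "(of_int u * of_int c + of_int v * of_int p :: complex) = 1"
    by (metis of_int_1 of_int_add of_int_mult)
  then have "x / of_int p = (of_int u * of_int c + of_int v * of_int p) * x / of_int p"
    by simp
  also have "\<dots> = of_int u * (of_int c * x / of_int p) + of_int v * x"
    using \<open>p \<noteq> 0\<close> by (simp add: field_simps)
  also have "\<dots> \<in> R" by (intro add scale assms)
  finally show ?thesis .
qed

lemma algebraic_int_coprime_divide:
  assumes "coprime c p" "p \<noteq> 0" "algebraic_int x" "algebraic_int (of_int c * x / of_int p)"
  shows "algebraic_int (x / of_int p :: complex)"
  using coprime_divide_closed[of "Collect algebraic_int" c p x] assms
  by (simp add: algebraic_int_add algebraic_int_mult algebraic_int_int)

lemma int_adjoin_coprime_divide:
  assumes "coprime c p" "p \<noteq> 0" "x \<in> int_adjoin \<theta>" "of_int c * x / of_int p \<in> int_adjoin \<theta>"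
  shows "x / of_int p \<in> int_adjoin \<theta>"
  using coprime_divide_closed[of "int_adjoin \<theta>" c p x] assms
  by (simp add: int_adjoin_add int_adjoin_mult int_adjoin_int)

section \<open>Irreducible polynomials and representatives of small degree\<close>

lemma map_poly_of_rat_add:
  "map_poly (of_rat :: rat \<Rightarrow> complex) (p + q) = map_poly of_rat p + map_poly of_rat q"
  by (rule poly_eqI) (simp add: coeff_map_poly of_rat_add)

lemma map_poly_of_rat_mult:
  "map_poly (of_rat :: rat \<Rightarrow> complex) (p * q) = map_poly of_rat p * map_poly of_rat q"
  by (rule poly_eqI) (simp add: coeff_map_poly coeff_mult of_rat_sum of_rat_mult)

lemma map_poly_of_rat_of_int:
  "map_poly (of_rat :: rat \<Rightarrow> complex) (map_poly of_int p) = map_poly of_int p"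
  by (rule poly_eqI) (simp add: coeff_map_poly)

text \<open>Otherwise \<open>f\<close> and \<open>h\<close> are coprime, and evaluating a Bezout
  identity at the common root gives \<open>0 = 1\<close>.\<close>

lemma irreducible_dvd_if_common_root:
  fixes f h :: "rat poly" and \<theta> :: complex
  assumes irr: "irreducible f" and f: "poly (map_poly of_rat f) \<theta> = 0"
    and h: "poly (map_poly of_rat h) \<theta> = 0"
  shows "f dvd h"
proof (rule ccontr)
  assume "\<not> f dvd h"
  have "coprime f h"
  proof (rule coprimeI)
    fix d assume d: "d dvd f" "d dvd h"
    then obtain k where "f = d * k" by (auto elim: dvdE)
    then have "is_unit d \<or> is_unit k" using irreducibleD[OF irr] by blast
    moreover have "\<not> is_unit k"
    proof
      assume "is_unit k"
      then have "f dvd d" unfolding \<open>f = d * k\<close> by (simp add: mult_unit_dvd_iff)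
      with d \<open>\<not> f dvd h\<close> show False using dvd_trans by blast
    qed
    ultimately show "is_unit d" by blast
  qed
  then have "gcd f h = 1" by (rule coprime_imp_gcd_eq_1)
  then obtain u v where "u * f + v * h = 1"
    using bezout_coefficients_fst_snd[of f h] by metis
  then have "map_poly (of_rat :: rat \<Rightarrow> complex) (u * f + v * h) = 1" by simp
  then have "poly (map_poly (of_rat :: rat \<Rightarrow> complex) (u * f + v * h)) \<theta> = 1" by simp
  with f h show False by (simp add: map_poly_of_rat_add map_poly_of_rat_mult)
qed

lemma ipoly_eq_0_imp_eq_0:
  fixes f h :: "int poly" and \<theta> :: complex
  assumes irr: "irreducible (map_poly rat_of_int f)" and f: "poly (map_poly of_int f) \<theta> = 0"
    and h: "poly (map_poly of_int h) \<theta> = 0" and "degree h < degree f"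
  shows "h = 0"
proof (rule ccontr)
  assume "h \<noteq> 0"
  have "map_poly rat_of_int f dvd map_poly rat_of_int h"
    using irreducible_dvd_if_common_root[OF irr, of \<theta> "map_poly rat_of_int h"] f h
    by (simp add: map_poly_of_rat_of_int)
  moreover have "map_poly rat_of_int h \<noteq> 0" using \<open>h \<noteq> 0\<close> by simp
  ultimately have "degree (map_poly rat_of_int f) \<le> degree (map_poly rat_of_int h)"
    by (rule dvd_imp_degree_le)
  with \<open>degree h < degree f\<close> show False by simp
qed

text \<open>Pseudo-division multiplies the dividend by a power of the leading coefficient, here 1,
  so it is true division over the integers.\<close>

lemma monic_int_poly_division:
  fixes f g :: "int poly"
  assumes "lead_coeff f = 1" "degree f > 0"
  obtains q r where "g = f * q + r" "degree r < degree f"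
proof -
  have "f \<noteq> 0" using assms by auto
  obtain q r where qr: "pseudo_divmod g f = (q, r)" by force
  from pseudo_divmod[OF \<open>f \<noteq> 0\<close> qr] assms have "g = f * q + r" "degree r < degree f" by auto
  then show ?thesis by (rule that)
qed

lemma int_adjoin_obtain_small_degree:
  assumes "lead_coeff f = 1" "degree f > 0" "poly (map_poly of_int f) \<theta> = 0" "x \<in> int_adjoin \<theta>"
  obtains r where "x = poly (map_poly of_int r) \<theta>" "degree r < degree f"
proof -
  obtain g where g: "x = poly (map_poly of_int g) \<theta>" using assms by (auto simp: int_adjoin_def)
  obtain q r where "g = f * q + r" "degree r < degree f"
    using monic_int_poly_division[OF assms(1,2)] .
  with g assms(3) show ?thesis
    by (intro that[of r]) (simp_all add: of_int_poly_hom.hom_add of_int_poly_hom.hom_mult)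
qed

text \<open>The powers of \<theta> below \<open>degree f\<close> are linearly independent, so the
  coefficients of \<open>h\<close> must be \<open>p\<close> times those of a small-degree
  representative of the quotient.\<close>

lemma dvd_coeff_if_divide_in_int_adjoin:
  assumes "lead_coeff f = 1" and irr: "irreducible (map_poly rat_of_int f)"
    and f: "poly (map_poly of_int f) \<theta> = 0"
    and "degree h < degree f" "p \<noteq> 0"
    and "poly (map_poly of_int h) \<theta> / of_int p \<in> int_adjoin \<theta>"
  shows "p dvd coeff h i"
proof -
  obtain r where r: "poly (map_poly of_int h) \<theta> / of_int p = poly (map_poly of_int r) \<theta>" "degree r < degree f"
    using int_adjoin_obtain_small_degree[of f] assms by (metis gr_zeroI not_less0)
  have "h - Polynomial.smult p r = 0"
  proof (rule ipoly_eq_0_imp_eq_0[OF irr f])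
    show "poly (map_poly of_int (h - Polynomial.smult p r)) \<theta> = 0"
      using r(1) \<open>p \<noteq> 0\<close> by (simp add: of_int_poly_hom.hom_minus of_int_hom.map_poly_hom_smult field_simps)
    show "degree (h - Polynomial.smult p r) < degree f"
      using r(2) \<open>degree h < degree f\<close> by (meson degree_diff_less degree_smult_le le_less_trans)
  qed
  then have "coeff h i = p * coeff r i" by (simp add: poly_eq_iff)
  then show ?thesis by simp
qed

lemma rat_poly_Ints_coeffs:
  fixes q :: "rat poly"
  assumes "\<And>i. coeff q i \<in> \<int>"
  obtains r where "q = map_poly of_int r"
proof (rule that)
  show "q = map_poly of_int (map_poly floor q)"
    using assms by (intro poly_eqI) (simp add: coeff_map_poly of_int_floor)
qed

text \<open>Separability in characteristic 0: the derivative is nonzero and of smaller degree, so it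
  shares no root with an irreducible polynomial.\<close>

lemma irreducible_root_not_root_pderiv:
  fixes f :: "int poly" and z :: complex
  assumes irr: "irreducible (map_poly rat_of_int f)" and "degree f > 0"
    and z: "poly (map_poly of_int f) z = 0"
  shows "poly (map_poly of_int (pderiv f)) z \<noteq> 0"
proof
  assume "poly (map_poly of_int (pderiv f)) z = 0"
  moreover have "degree (pderiv f) < degree f" using \<open>degree f > 0\<close> by (simp add: degree_pderiv)
  ultimately have "pderiv f = 0" using ipoly_eq_0_imp_eq_0[OF irr z] by blast
  with \<open>degree f > 0\<close> show False by (simp add: pderiv_eq_0_iff)
qed

text \<open>The classical inclusion of \<open>f'(\<theta>)\<close> times the ring of integers in
  \<open>int_adjoin \<theta>\<close>, obtained by Lagrange interpolation over the conjugates. It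
  bounds the denominators of integral elements.\<close>

lemma pderiv_times_algebraic_int_in_int_adjoin:
  fixes f :: "int poly" and G :: "rat poly" and \<theta> :: complex
  assumes monic: "lead_coeff f = 1" and irr: "irreducible (map_poly rat_of_int f)" and deg: "degree f > 0"
    and root: "poly (map_poly of_int f) \<theta> = 0"
    and int: "algebraic_int (poly (map_poly of_rat G) \<theta>)"
  shows "poly (map_poly of_int (pderiv f)) \<theta> * poly (map_poly of_rat G) \<theta> \<in> int_adjoin \<theta>"
proof -
  let ?f = "map_poly of_int f :: complex poly" and ?fQ = "map_poly of_int f :: rat poly"
  let ?G = "map_poly of_rat G :: complex poly"
  define Z where "Z = {z. poly ?f z = 0}"
  have "?f \<noteq> 0" using deg by auto
  then have finZ: "finite Z" unfolding Z_def by (rule poly_roots_finite)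
  have algZ: "algebraic_int z" if "z \<in> Z" for z
    using that monic unfolding Z_def algebraic_int_altdef_ipoly by blast
  \<comment> \<open>If a monic integer polynomial \<open>P\<close> kills \<open>G(\<theta>)\<close>,
    then irreducibility makes \<open>f\<close> divide the composition of \<open>P\<close> with
    \<open>G\<close>. Hence \<open>P\<close> kills the conjugates \<open>G(z)\<close> as
    well.\<close>
  have algG: "algebraic_int (poly ?G z)" if "z \<in> Z" for z
  proof -
    obtain P where P: "poly (map_poly of_int P) (poly ?G \<theta>) = 0" "lead_coeff P = 1"
      using int unfolding algebraic_int_altdef_ipoly by metis
    have comp: "poly (map_poly of_rat (map_poly of_int P \<circ>\<^sub>p G)) x = poly (map_poly of_int P) (poly ?G x)"
      for x :: complex
      by (simp add: of_rat_hom.map_poly_pcompose map_poly_of_rat_of_int poly_pcompose)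
    have "?fQ dvd (map_poly of_int P \<circ>\<^sub>p G)"
      using irreducible_dvd_if_common_root[OF irr, of \<theta>] root P comp
      by (simp add: map_poly_of_rat_of_int)
    then obtain h where h: "map_poly of_int P \<circ>\<^sub>p G = ?fQ * h" by (auto elim: dvdE)
    have "poly (map_poly of_int P) (poly ?G z) = poly (map_poly of_rat (?fQ * h)) z"
      unfolding comp[symmetric] h ..
    also have "\<dots> = 0" using that by (simp add: map_poly_of_rat_mult map_poly_of_rat_of_int Z_def)
    finally show ?thesis using P(2) unfolding algebraic_int_altdef_ipoly by metis
  qed
  have "rsquarefree ?f"
    unfolding rsquarefree_roots
    using irreducible_root_not_root_pderiv[OF irr deg] by (auto simp: of_int_hom.map_poly_pderiv)
  from complex_poly_decompose_rsquarefree[OF this] monic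
  have fprod: "?f = (\<Prod>z\<in>Z. [:-z, 1:])" by (simp add: Z_def)
  have "degree (\<Prod>z\<in>Z. [:-z, 1:]) = card Z"
    by (subst degree_prod_sum_eq) auto
  then have cardZ: "card Z = degree f" by (simp flip: fprod)
  \<comment> \<open>This is the Lagrange formula without its denominators \<open>f'(z)\<close>: the
    value at a root \<open>z\<close> is \<open>G(z) f'(z)\<close>, and the coefficients are built
    from algebraic integers.\<close>
  define R where "R = (\<Sum>z\<in>Z. Polynomial.smult (poly ?G z) (\<Prod>w\<in>Z - {z}. [:-w, 1:]))"
  define R' where "R' = (G * pderiv ?fQ) mod ?fQ"
  have deriv: "poly (map_poly of_int (pderiv f)) z = (\<Prod>w\<in>Z - {z}. z - w)" if "z \<in> Z" for z
  proof -
    have "poly (map_poly of_int (pderiv f)) z = poly (pderiv ?f) z"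
      by (simp add: of_int_hom.map_poly_pderiv)
    also have "\<dots> = (\<Sum>a\<in>Z. \<Prod>w\<in>Z - {a}. z - w)"
      unfolding fprod pderiv_prod by (simp add: poly_sum poly_prod pderiv_pCons)
    \<comment> \<open>Every summand with \<open>a \<noteq> z\<close> contains the factor
      \<open>z - z\<close>.\<close>
    also have "\<dots> = (\<Sum>a\<in>Z. if a = z then \<Prod>w\<in>Z - {z}. z - w else 0)"
      using that finZ by (intro sum.cong) auto
    also have "\<dots> = (\<Prod>w\<in>Z - {z}. z - w)" using that finZ by simp
    finally show ?thesis .
  qed
  have R: "poly R z = poly ?G z * (\<Prod>w\<in>Z - {z}. z - w)" if "z \<in> Z" for z
  proof -
    have "poly R z = (\<Sum>a\<in>Z. poly ?G a * (\<Prod>w\<in>Z - {a}. z - w))"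
      by (simp add: R_def poly_sum poly_prod)
    also have "\<dots> = (\<Sum>a\<in>Z. if a = z then poly ?G z * (\<Prod>w\<in>Z - {z}. z - w) else 0)"
      using that finZ by (intro sum.cong) auto
    also have "\<dots> = poly ?G z * (\<Prod>w\<in>Z - {z}. z - w)" using that finZ by simp
    finally show ?thesis .
  qed
  have R': "poly (map_poly of_rat R') z = poly ?G z * poly (map_poly of_int (pderiv f)) z" if "z \<in> Z" for z
  proof -
    have "G * pderiv ?fQ = ?fQ * ((G * pderiv ?fQ) div ?fQ) + R'"
      unfolding R'_def by simp
    then have "poly (map_poly of_rat (G * pderiv ?fQ)) z = poly (map_poly of_rat (?fQ * ((G * pderiv ?fQ) div ?fQ) + R')) z"
      by simp
    then have "poly (map_poly of_rat R') z = poly (map_poly of_rat (G * pderiv ?fQ)) z"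
      using that by (simp add: map_poly_of_rat_add map_poly_of_rat_mult map_poly_of_rat_of_int Z_def)
    also have "\<dots> = poly ?G z * poly (map_poly of_int (pderiv f)) z"
      by (simp add: map_poly_of_rat_mult map_poly_of_rat_of_int flip: of_int_hom.map_poly_pderiv)
    finally show ?thesis .
  qed
  \<comment> \<open>Both polynomials interpolate the conjugates of \<open>G(\<theta>) f'(\<theta>)\<close>: one has rational, the other
    integral coefficients.\<close>
  have "map_poly of_rat R' = R"
  proof (rule poly_eqI_degree[of Z])
    show "poly (map_poly of_rat R') z = poly R z" if "z \<in> Z" for z
      using that by (simp add: R R' deriv)
    have "degree R' < degree f"
    proof -
      have "?fQ \<noteq> 0" using deg by auto
      from degree_mod_less[OF this, of "G * pderiv ?fQ"] show ?thesis
        using deg unfolding R'_def by (elim disjE) simp_all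
    qed
    then show "degree (map_poly of_rat R' :: complex poly) < card Z"
      unfolding cardZ using degree_map_poly_le le_less_trans by blast
    show "degree R < card Z"
      unfolding R_def
    proof (rule degree_sum_less)
      fix z assume "z \<in> Z"
      have "degree (Polynomial.smult (poly ?G z) (\<Prod>w\<in>Z - {z}. [:-w, 1:])) \<le> degree (\<Prod>w\<in>Z - {z}. [:-w, 1:])"
        by (rule degree_smult_le)
      also have "\<dots> = card (Z - {z})" by (subst degree_prod_sum_eq) auto
      also have "\<dots> < card Z" using \<open>z \<in> Z\<close> finZ by (meson card_Diff1_less)
      finally show "degree (Polynomial.smult (poly ?G z) (\<Prod>w\<in>Z - {z}. [:-w, 1:])) < card Z" .
    qed (use cardZ deg in simp)
  qed
  moreover have "algebraic_int (coeff R i)" for i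
    unfolding R_def coeff_sum coeff_smult
    by (intro algebraic_int_sum algebraic_int_mult algG algebraic_int_coeff_prod)
       (auto simp: coeff_pCons algZ algebraic_int_one split: nat.split)
  ultimately have "coeff R' i \<in> \<int>" for i
    by (metis algebraic_int_rat_imp_Ints coeff_map_poly of_rat_0)
  then obtain r where "R' = map_poly of_int r" using rat_poly_Ints_coeffs by blast
  moreover have "\<theta> \<in> Z" using root by (simp add: Z_def)
  ultimately have "poly (map_poly of_int (pderiv f)) \<theta> * poly ?G \<theta> = poly (map_poly of_int r) \<theta>"
    using R'[of \<theta>] by (simp add: map_poly_of_rat_of_int mult.commute)
  then show ?thesis using int_adjoin_ipoly by simp
qed

section \<open>Gauss's lemma and Eisenstein's criterion\<close>

lemma algebraic_int_coeff_prod_mset: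
  assumes "\<And>x. x \<in># A \<Longrightarrow> algebraic_int (x :: complex)"
  shows "algebraic_int (coeff (\<Prod>x\<in>#A. [:-x, 1:]) i)"
  using assms
proof (induction A arbitrary: i)
  case (add x A)
  then show ?case
    unfolding image_mset_add_mset prod_mset.add_mset
    by (intro algebraic_int_coeff_mult) (auto simp: coeff_pCons algebraic_int_one split: nat.split)
qed (auto simp: coeff_1 algebraic_int_one)

text \<open>Gauss's lemma for monic polynomials: the complex roots of \<open>g\<close> are roots of
  \<open>f\<close>, hence algebraic integers, and so are the coefficients of \<open>g\<close>, which
  are polynomials in these roots. Being rational, they are integers.\<close>

lemma monic_rat_divisor_of_int_poly:
  fixes f :: "int poly" and g :: "rat poly"
  assumes f: "lead_coeff f = 1" and g: "lead_coeff g = 1" and dvd: "g dvd map_poly of_int f"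
  obtains r where "g = map_poly of_int r"
proof -
  let ?g = "map_poly of_rat g :: complex poly"
  have lc: "lead_coeff ?g = 1"
    using g by simp
  have "algebraic_int (coeff ?g i)" for i
  proof -
    have "?g = (\<Prod>x\<in>#proots ?g. [:-x, 1:])"
      using complex_poly_decompose_multiset[of ?g] lc by simp
    moreover have "algebraic_int x" if "x \<in># proots ?g" for x
    proof -
      have "?g \<noteq> 0" using lc by auto
      with that have "poly ?g x = 0" by simp
      moreover obtain h where "map_poly of_int f = g * h" using dvd by (auto elim: dvdE)
      then have "map_poly of_rat (map_poly of_int f) = ?g * map_poly of_rat h"
        by (simp add: map_poly_of_rat_mult)
      ultimately have "poly (map_poly of_int f) x = 0" by (simp add: map_poly_of_rat_of_int)
      with f show ?thesis unfolding algebraic_int_altdef_ipoly by blast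
    qed
    ultimately show ?thesis using algebraic_int_coeff_prod_mset[of "proots ?g" i] by simp
  qed
  then have "coeff g i \<in> \<int>" for i
    by (simp add: coeff_map_poly algebraic_int_rat_imp_Ints)
  then show ?thesis using rat_poly_Ints_coeffs that by blast
qed

text \<open>Of two monic integer factors, one has a constant coefficient divisible by
  \<open>p\<close>, and then the other has not, as \<open>p^2\<close> does not divide
  \<open>coeff f 0\<close>. This situation is ruled out by \<open>no_factor\<close>.\<close>

lemma eisenstein_irreducible:
  fixes f :: "int poly" and p :: int
  assumes monic: "lead_coeff f = 1" and deg: "degree f > 0" and p: "prime p"
    and low: "\<And>i. i < degree f \<Longrightarrow> p dvd coeff f i" and "\<not> p\<^sup>2 dvd coeff f 0"
  shows "irreducible (map_poly rat_of_int f)"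
proof -
  have no_factor: False
    if gh: "f = g * h" and g: "p dvd coeff g 0" "lead_coeff g = 1" and h: "degree h > 0"
      and nd: "\<not> p dvd coeff h 0" for g h
  proof -
    have "g \<noteq> 0" "h \<noteq> 0" using g h by auto
    then have dg: "degree g < degree f" using gh h by (simp add: degree_mult_eq)
    \<comment> \<open>At the first coefficient of \<open>g\<close> not divisible by
      \<open>p\<close>, the coefficient of the product is congruent to
      \<open>coeff g i * coeff h 0\<close> modulo \<open>p\<close>. The index lies below
      \<open>degree f\<close> because \<open>h\<close> is not constant.\<close>
    define i where "i = (LEAST i. \<not> p dvd coeff g i)"
    have ex: "\<not> p dvd coeff g (degree g)" using g(2) p not_prime_unit by metis
    have i: "\<not> p dvd coeff g i" unfolding i_def by (rule LeastI[of "\<lambda>i. \<not> p dvd coeff g i", OF ex])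
    have "i \<le> degree g" unfolding i_def by (rule Least_le[of "\<lambda>i. \<not> p dvd coeff g i", OF ex])
    then have "p dvd coeff f i" using low dg by simp
    moreover have "coeff f i = coeff g i * coeff h 0 + (\<Sum>j<i. coeff g j * coeff h (i - j))"
      unfolding gh coeff_mult by (simp add: lessThan_Suc_atMost[symmetric])
    moreover have "p dvd (\<Sum>j<i. coeff g j * coeff h (i - j))"
      by (intro dvd_sum dvd_mult2) (use not_less_Least in \<open>auto simp: i_def\<close>)
    ultimately have "p dvd coeff g i * coeff h 0" by (metis dvd_add_left_iff)
    with p i nd show False by (simp add: prime_dvd_mult_iff)
  qed
  show ?thesis
  proof (rule irreducibleI)
    show "map_poly rat_of_int f \<noteq> 0" using deg by auto
    show "\<not> map_poly rat_of_int f dvd 1" using deg by (auto simp: is_unit_poly_iff)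
    fix a c assume ac: "map_poly rat_of_int f = a * c"
    show "a dvd 1 \<or> c dvd 1"
    proof (rule ccontr)
      assume contra: "\<not> (a dvd 1 \<or> c dvd 1)"
      have ac0: "a \<noteq> 0" "c \<noteq> 0" using ac deg by auto
      have da: "degree a > 0" "degree c > 0"
        using contra ac0 by (auto simp: is_unit_iff_degree)
      \<comment> \<open>Rescaling makes both factors monic, so that Gauss's lemma gives them integer
        coefficients.\<close>
      define g h where "g = Polynomial.smult (inverse (lead_coeff a)) a" and "h = Polynomial.smult (lead_coeff a) c"
      have gh: "map_poly rat_of_int f = g * h" using ac ac0 by (simp add: g_def h_def)
      have lg: "lead_coeff g = 1" using ac0 by (simp add: g_def)
      have "lead_coeff (map_poly rat_of_int f) = 1" using monic by simp
      then have lh: "lead_coeff h = 1" unfolding gh using lg by (simp add: lead_coeff_mult)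
      obtain g0 where g0: "g = map_poly of_int g0"
        using monic_rat_divisor_of_int_poly[OF monic lg] gh by (metis dvd_triv_left)
      obtain h0 where h0: "h = map_poly of_int h0"
        using monic_rat_divisor_of_int_poly[OF monic lh] gh by (metis dvd_triv_right)
      have "map_poly rat_of_int f = map_poly rat_of_int (g0 * h0)"
        unfolding gh g0 h0 by (simp add: of_int_poly_hom.hom_mult)
      then have f: "f = g0 * h0" by simp
      have l0: "lead_coeff g0 = 1" "lead_coeff h0 = 1" using lg lh by (auto simp: g0 h0)
      have d0: "degree g0 > 0" "degree h0 > 0"
      proof -
        have "degree (map_poly rat_of_int g0) = degree a" "degree (map_poly rat_of_int h0) = degree c"
          unfolding g0[symmetric] h0[symmetric] using ac0 by (simp_all add: g_def h_def)
        then show "degree g0 > 0" "degree h0 > 0" using da by simp_all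
      qed
      have c0: "coeff f 0 = coeff g0 0 * coeff h0 0" by (simp add: f coeff_mult)
      have "p dvd coeff f 0" using low deg by simp
      then consider "p dvd coeff g0 0" | "p dvd coeff h0 0" using p c0 by (auto simp: prime_dvd_mult_iff)
      then show False
      proof cases
        case 1
        then show False using no_factor[OF f 1 l0(1) d0(2)] \<open>\<not> p\<^sup>2 dvd coeff f 0\<close> c0
          by (metis mult_dvd_mono power2_eq_square)
      next
        case 2
        then show False using no_factor[of h0 g0] f l0 d0 \<open>\<not> p\<^sup>2 dvd coeff f 0\<close> c0
          by (metis mult_dvd_mono power2_eq_square mult.commute)
      qed
    qed
  qed
qed

section \<open>The trinomial\<close>

lemma lead_coeff_synthetic_div:
  assumes "degree p > 0"
  shows "lead_coeff (synthetic_div p c) = lead_coeff p"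
proof -
  obtain d where d: "degree p = Suc d" using assms by (metis gr0_implies_Suc)
  have "coeff (p + Polynomial.smult c (synthetic_div p c)) (Suc d)
      = coeff (pCons (poly p c) (synthetic_div p c)) (Suc d)"
    by (simp only: synthetic_div_correct)
  then show ?thesis using d by (simp add: degree_synthetic_div coeff_eq_0)
qed

lemma coeff_trinom: "coeff (trinom n b) i = (if i = n then 1 else 0) + (if i \<le> 1 then b else 0)"
  by (auto simp: trinom_def coeff_pCons split: nat.splits)

lemma degree_trinom:
  assumes "n > 2"
  shows "degree (trinom n b) = n"
proof -
  have "degree [:b, b:] < degree (monom (1 :: int) n)" using assms by (simp add: degree_monom_eq)
  then show ?thesis unfolding trinom_def by (subst degree_add_eq_left) (simp_all add: degree_monom_eq)
qed

lemma lead_coeff_trinom: "n > 2 \<Longrightarrow> lead_coeff (trinom n b) = 1"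
  by (simp add: degree_trinom coeff_trinom)

lemma poly_trinom: "poly (map_poly of_int (trinom n b)) (x :: complex) = x ^ n + of_int b * (x + 1)"
  by (simp add: trinom_def ipoly_pCons of_int_poly_hom.hom_add map_poly_monom poly_monom algebra_simps)

section \<open>Roots of the trinomial, and the primes dividing \<open>b\<close>\<close>

locale trinom_root =
  fixes n :: nat and b :: int and \<theta> :: complex
  assumes n: "n > 2" and irr: "irreducible (map_poly rat_of_int (trinom n b))"
    and root: "poly (map_poly of_int (trinom n b)) \<theta> = 0"
begin

lemma theta_pow: "\<theta> ^ n = - of_int b * (\<theta> + 1)"
  using root unfolding poly_trinom by (simp add: eq_neg_iff_add_eq_0)

lemma algebraic_int_theta: "algebraic_int \<theta>"
  using root lead_coeff_trinom[OF n] unfolding algebraic_int_altdef_ipoly by blast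

lemma algebraic_int_int_adjoin: "x \<in> int_adjoin \<theta> \<Longrightarrow> algebraic_int x"
  by (rule int_adjoin_imp_algebraic_int[OF algebraic_int_theta])

text \<open>The trinomial takes the value \<open>(- 1) ^ n\<close> at \<open>-1\<close>, so
  \<open>\<theta> + 1\<close> divides a unit. The inverse is explicit: a geometric sum in
  \<open>- \<theta>\<close>, corrected by means of \<open>theta_pow\<close>.\<close>

lemma theta_plus_1_unit: obtains \<eta> where "\<eta> \<in> int_adjoin \<theta>" "(\<theta> + 1) * \<eta> = 1"
proof -
  define s where "s = (\<Sum>i<n. (- \<theta>) ^ i)"
  have "s \<in> int_adjoin \<theta>" unfolding s_def
    by (intro int_adjoin_sum int_adjoin_pow int_adjoin_uminus int_adjoin_gen)
  then have mem: "s - of_int ((- 1) ^ n * b) \<in> int_adjoin \<theta>"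
    by (intro int_adjoin_diff int_adjoin_int)
  have "(\<theta> + 1) * s = 1 - (- \<theta>) ^ n"
    unfolding s_def using one_diff_power_eq[of "- \<theta>" n] by (simp add: add.commute)
  also have "(- \<theta>) ^ n = (- 1) ^ n * \<theta> ^ n" by (simp add: power_minus[of \<theta>])
  also have "1 - \<dots> = 1 + (- 1) ^ n * of_int b * (\<theta> + 1)" by (simp add: theta_pow algebra_simps)
  finally have "(\<theta> + 1) * (s - of_int ((- 1) ^ n * b)) = 1" by (simp add: algebra_simps)
  with mem show ?thesis by (rule that)
qed

text \<open>The trinomial is Eisenstein at \<open>p\<close>. With \<open>x\<close> written in powers
  of \<theta>, the coefficients are shown to be divisible by \<open>p\<close> one after the other,
  from the lowest up.\<close>

lemma divide_in_int_adjoin_if_dvd_coeff: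
  assumes p: "prime p" "p dvd b" "\<not> p\<^sup>2 dvd b"
    and x: "x \<in> int_adjoin \<theta>" "algebraic_int (x / of_int p)"
  shows "x / of_int p \<in> int_adjoin \<theta>"
proof -
  have "p \<noteq> 0" using p by auto
  obtain r where r: "x = poly (map_poly of_int r) \<theta>" "degree r < n"
    using int_adjoin_obtain_small_degree[OF lead_coeff_trinom[OF n] _ root x(1)] n by (auto simp: degree_trinom)
  have x_sum: "x = (\<Sum>i<n. of_int (coeff r i) * \<theta> ^ i)"
  proof -
    have "x = (\<Sum>i\<le>degree r. of_int (coeff r i) * \<theta> ^ i)"
      unfolding r by (simp add: poly_altdef coeff_map_poly)
    also have "\<dots> = (\<Sum>i<n. of_int (coeff r i) * \<theta> ^ i)"
      using r(2) by (intro sum.mono_neutral_left) (auto simp: coeff_eq_0)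
    finally show ?thesis .
  qed
  have "p dvd coeff r j" for j
  proof (induction j rule: less_induct)
    case (less j)
    show ?case
    proof (cases "j < n")
      case False
      then show ?thesis using r(2) by (simp add: coeff_eq_0)
    next
      case True
      define c where "c = coeff r j"
      obtain b' where b': "b = p * b'" using p by (auto elim: dvdE)
      have th: "\<theta> ^ n / of_int p = - of_int b' * (\<theta> + 1)"
        unfolding theta_pow b' using \<open>p \<noteq> 0\<close> by simp
      \<comment> \<open>This power of \<theta> moves the term of index \<open>j\<close> to
        \<open>\<theta> ^ (n - 1)\<close>. Terms before it are integral by induction; terms after it
        contain \<open>\<theta> ^ n / p\<close>, which lies in
        \<open>int_adjoin \<theta>\<close>.\<close>
      have "algebraic_int (\<theta> ^ (n - 1 - j) * (x / of_int p))"
        by (intro algebraic_int_mult algebraic_int_pow algebraic_int_theta x)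
      also have "\<theta> ^ (n - 1 - j) * (x / of_int p)
          = (\<Sum>i<n. of_int (coeff r i) * \<theta> ^ (i + (n - 1 - j)) / of_int p)"
        unfolding x_sum by (simp add: sum_distrib_left sum_divide_distrib power_add mult_ac)
      also have "\<dots> = of_int c * \<theta> ^ (n - 1) / of_int p
          + (\<Sum>i\<in>{..<n} - {j}. of_int (coeff r i) * \<theta> ^ (i + (n - 1 - j)) / of_int p)"
        using True by (subst sum.remove[of _ j]) (auto simp: c_def)
      finally have whole: "algebraic_int (of_int c * \<theta> ^ (n - 1) / of_int p
          + (\<Sum>i\<in>{..<n} - {j}. of_int (coeff r i) * \<theta> ^ (i + (n - 1 - j)) / of_int p))" .
      have rest: "algebraic_int (\<Sum>i\<in>{..<n} - {j}. of_int (coeff r i) * \<theta> ^ (i + (n - 1 - j)) / of_int p)"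
      proof (rule algebraic_int_sum)
        fix i assume i: "i \<in> {..<n} - {j}"
        show "algebraic_int (of_int (coeff r i) * \<theta> ^ (i + (n - 1 - j)) / of_int p)"
        proof (cases "i < j")
          case True
          then obtain k where "coeff r i = p * k" using less.IH by (auto elim: dvdE)
          then have "of_int (coeff r i) * \<theta> ^ (i + (n - 1 - j)) / of_int p = of_int k * \<theta> ^ (i + (n - 1 - j))"
            using \<open>p \<noteq> 0\<close> by simp
          then show ?thesis
            by (simp add: algebraic_int_mult algebraic_int_pow algebraic_int_theta algebraic_int_int)
        next
          case False
          then have "i + (n - 1 - j) = n + (i - 1 - j)" using i \<open>j < n\<close> by auto
          then have "of_int (coeff r i) * \<theta> ^ (i + (n - 1 - j)) / of_int p
              = of_int (coeff r i) * ((\<theta> ^ n / of_int p) * \<theta> ^ (i - 1 - j))"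
            by (simp add: power_add)
          also have "algebraic_int \<dots>"
            unfolding th by (intro algebraic_int_int_adjoin int_adjoin_mult int_adjoin_uminus
              int_adjoin_add int_adjoin_pow int_adjoin_gen int_adjoin_int int_adjoin_int[of 1, simplified])
          finally show ?thesis .
        qed
      qed
      from algebraic_int_diff[OF whole rest] have y: "algebraic_int (of_int c * \<theta> ^ (n - 1) / of_int p)"
        by simp
      \<comment> \<open>In the \<open>n\<close>-th power of the remaining term, \<open>n - 1\<close>
        of the \<open>n\<close> factors \<open>p\<close> in the denominator are absorbed by
        \<open>(\<theta> ^ n / p) ^ (n - 1)\<close> and one is left. Once the unit
        \<open>\<theta> + 1\<close> is cancelled, the numerator is the integer
        \<open>C\<close>.\<close>
      define C where "C = c ^ n * (- b') ^ (n - 1)"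
      obtain \<eta> where \<eta>: "\<eta> \<in> int_adjoin \<theta>" "(\<theta> + 1) * \<eta> = 1" by (rule theta_plus_1_unit)
      have "(of_int c * \<theta> ^ (n - 1) / of_int p) ^ n = of_int (c ^ n) * (\<theta> ^ n / of_int p) ^ (n - 1) / of_int p"
      proof -
        have "(of_int p :: complex) ^ n = of_int p ^ (n - 1) * of_int p"
          using n by (metis power_minus_mult gr_implies_not0 neq0_conv)
        then show ?thesis
          by (simp add: power_divide power_mult_distrib mult.commute flip: power_mult)
      qed
      also have "\<dots> = of_int C * (\<theta> + 1) ^ (n - 1) / of_int p"
        unfolding th C_def power_mult_distrib by simp
      finally have "algebraic_int (of_int C * (\<theta> + 1) ^ (n - 1) / of_int p)"
        using algebraic_int_pow[OF y, of n] by simp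
      then have "algebraic_int (of_int C * (\<theta> + 1) ^ (n - 1) / of_int p * \<eta> ^ (n - 1))"
        by (rule algebraic_int_mult[OF _ algebraic_int_pow[OF algebraic_int_int_adjoin[OF \<eta>(1)]]])
      also have "of_int C * (\<theta> + 1) ^ (n - 1) / of_int p * \<eta> ^ (n - 1) = of_int C / of_int p * ((\<theta> + 1) * \<eta>) ^ (n - 1)"
        unfolding power_mult_distrib by simp
      finally have "algebraic_int (of_int C / of_int p :: complex)" unfolding \<eta>(2) by simp
      then have "p dvd C" using algebraic_int_div_imp_dvd \<open>p \<noteq> 0\<close> by blast
      then have "p dvd c \<or> p dvd b'"
        unfolding C_def using p(1) by (metis dvd_minus_iff prime_dvd_mult_iff prime_dvd_power)
      moreover have "\<not> p dvd b'" using p(3) unfolding b' power2_eq_square using \<open>p \<noteq> 0\<close> by simp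
      ultimately show ?thesis by (simp add: c_def)
    qed
  qed
  then have "\<forall>j. \<exists>k. coeff r j = p * k" by (auto elim: dvdE)
  then obtain k where k: "\<And>j. coeff r j = p * k j" by metis
  have "x / of_int p = (\<Sum>i<n. of_int (k i) * \<theta> ^ i)"
    unfolding x_sum sum_divide_distrib k using \<open>p \<noteq> 0\<close> by simp
  also have "\<dots> \<in> int_adjoin \<theta>"
    by (intro int_adjoin_sum int_adjoin_mult int_adjoin_int int_adjoin_pow int_adjoin_gen)
  finally show ?thesis .
qed

section \<open>Primes not dividing \<open>b\<close>\<close>

definition lam :: complex where "lam = of_int (int n - 1) * \<theta> + of_int (int n)"

text \<open>Up to sign, the discriminant of the trinomial is \<open>b^(n-1) * disc\<close>, and
  \<open>\<theta> f'(\<theta>) = - b * lam\<close>.\<close>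
definition disc :: int where "disc = (- int n) ^ n - b * (int n - 1) ^ (n - 1)"

lemma lam_in: "lam \<in> int_adjoin \<theta>"
  unfolding lam_def by (intro int_adjoin_add int_adjoin_mult int_adjoin_int int_adjoin_gen)

text \<open>Since \<open>\<theta> f'(\<theta>) = - b * lam\<close> and \<open>b\<close> is
  invertible modulo \<open>p\<close>, the denominator bound by \<open>f'(\<theta>)\<close> becomes
  one by \<open>lam\<close>.\<close>

lemma lam_times_algebraic_int:
  assumes p: "prime p" "\<not> p dvd b" and x: "x \<in> int_adjoin \<theta>" "algebraic_int (x / of_int p)"
  shows "lam * x / of_int p \<in> int_adjoin \<theta>"
proof -
  have "p \<noteq> 0" using p by auto
  obtain H where H: "x = poly (map_poly of_int H) \<theta>" using x by (auto simp: int_adjoin_def)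
  define G :: "rat poly" where "G = Polynomial.smult (inverse (of_int p)) (map_poly of_int H)"
  have "map_poly (of_rat :: rat \<Rightarrow> complex) G = Polynomial.smult (inverse (of_int p)) (map_poly of_int H)"
    by (rule poly_eqI) (simp add: G_def coeff_map_poly of_rat_mult of_rat_inverse)
  then have G: "poly (map_poly of_rat G) \<theta> = x / of_int p"
    by (simp add: H field_simps)
  let ?f' = "poly (map_poly of_int (pderiv (trinom n b))) \<theta> :: complex"
  have "?f' * (x / of_int p) \<in> int_adjoin \<theta>"
    using pderiv_times_algebraic_int_in_int_adjoin[OF lead_coeff_trinom[OF n] irr _ root, of G] x n
    by (simp add: G degree_trinom)
  then have "- \<theta> * (?f' * (x / of_int p)) \<in> int_adjoin \<theta>"
    by (rule int_adjoin_mult[OF int_adjoin_uminus[OF int_adjoin_gen]])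
  moreover have "\<theta> * ?f' = - of_int b * lam"
  proof -
    have "?f' = of_nat n * \<theta> ^ (n - 1) + of_int b"
      by (simp add: trinom_def pderiv_add pderiv_monom pderiv_pCons ipoly_pCons of_int_poly_hom.hom_add
        map_poly_monom poly_monom)
    then have "\<theta> * ?f' = of_nat n * (\<theta> ^ (n - 1) * \<theta>) + of_int b * \<theta>"
      by (simp add: algebra_simps)
    also have "\<theta> ^ (n - 1) * \<theta> = \<theta> ^ n" using power_minus_mult[of n \<theta>] n by simp
    finally show ?thesis by (simp add: theta_pow lam_def algebra_simps)
  qed
  ultimately have "of_int b * (lam * x) / of_int p \<in> int_adjoin \<theta>"
    by (metis (no_types, lifting) minus_mult_left minus_minus mult.assoc times_divide_eq_right)
  then show ?thesis
    using int_adjoin_coprime_divide[OF _ \<open>p \<noteq> 0\<close>, of b "lam * x"] p x lam_in prime_imp_coprime[of p b]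
    by (simp add: int_adjoin_mult coprime_commute)
qed

text \<open>This is the Taylor expansion at \<open>y = -n\<close> of \<open>F(y) = (n-1)^n f(y/(n-1))\<close>: the value and the
  derivative of \<open>F\<close> there are \<open>disc\<close> and \<open>-disc\<close>.\<close>
lemma lam_equation:
  obtains K where "degree ([:int n, int n - 1:] * K) = n - 1"
    "lead_coeff ([:int n, int n - 1:] * K) = (int n - 1) ^ (n - 1)"
    "of_int disc * (1 - lam) + lam\<^sup>2 * poly (map_poly of_int K) \<theta> = 0"
proof -
  define m where "m = int n - 1"
  have m: "m \<noteq> 0" using n by (simp add: m_def)
  define F where "F = monom 1 n + [:b * m ^ n, b * m ^ (n - 1):]"
  have degF: "degree F = n"
  proof -
    have "degree [:b * m ^ n, b * m ^ (n - 1):] < degree (monom (1 :: int) n)"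
      using n by (simp add: degree_monom_eq)
    then show ?thesis unfolding F_def by (subst degree_add_eq_left) (simp_all add: degree_monom_eq)
  qed
  have lcF: "lead_coeff F = 1"
    using n unfolding degF by (auto simp: F_def coeff_pCons split: nat.splits)
  \<comment> \<open>Dividing twice by \<open>y + n\<close> gives the expansion
    \<open>F(y) = (y + n)^2 K2(y) + F'(-n) (y + n) + F(-n)\<close>.\<close>
  define Q where "Q = synthetic_div F (- int n)"
  define K2 where "K2 = synthetic_div Q (- int n)"
  have deg: "degree Q = n - 1" "degree K2 = n - 2"
    by (simp_all add: Q_def K2_def degree_synthetic_div degF)
  have lc: "lead_coeff K2 = 1"
    using lead_coeff_synthetic_div[of F "- int n"] lead_coeff_synthetic_div[of Q "- int n"] n
    unfolding K2_def[symmetric] Q_def[symmetric] by (simp add: lcF[unfolded degF] degF deg)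
  have F: "F = [:int n, 1:] * Q + [:poly F (- int n):]"
    using synthetic_div_correct'[of "- int n" F] by (simp add: Q_def)
  have Q: "Q = [:int n, 1:] * K2 + [:poly Q (- int n):]"
    using synthetic_div_correct'[of "- int n" Q] by (simp add: K2_def)
  have pw: "(- int n) ^ n = (- int n) ^ (n - 1) * (- int n)" "m ^ n = m ^ (n - 1) * m"
    using power_minus_mult[of n "- int n"] power_minus_mult[of n m] n by simp_all
  have F0: "poly F (- int n) = disc"
    unfolding F_def disc_def m_def[symmetric] by (simp add: poly_monom pw(2)) (simp add: m_def algebra_simps)
  have "pderiv F = pderiv ([:int n, 1:] * Q + [:poly F (- int n):])" using F by simp
  then have "poly (pderiv F) (- int n) = poly Q (- int n)"
    by (simp add: pderiv_add pderiv_mult pderiv_pCons pderiv_smult)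
  then have Q0: "poly Q (- int n) = - disc"
    unfolding F_def disc_def m_def[symmetric] pw(1)
    by (simp add: pderiv_add pderiv_monom pderiv_pCons poly_monom mult.commute)
  \<comment> \<open>The substitution \<open>y = (n - 1) * \<theta>\<close> turns
    \<open>y + n\<close> into \<open>lam\<close>. Thus \<open>[:int n, m:] * K\<close> is the
    polynomial whose value at \<theta> is \<open>lam * K(\<theta>)\<close>.\<close>
  define K where "K = K2 \<circ>\<^sub>p [:0, m:]"
  have K: "degree K = n - 2" "lead_coeff K = m ^ (n - 2)"
  proof -
    show "degree K = n - 2" using m by (simp add: K_def degree_pcompose deg)
    have "lead_coeff K = lead_coeff K2 * lead_coeff [:0, m:] ^ degree K2"
      unfolding K_def using m by (intro lead_coeff_comp) simp
    then show "lead_coeff K = m ^ (n - 2)" using m lc by (simp add: deg)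
  qed
  have "K \<noteq> 0" using K m by auto
  then have "degree ([:int n, m:] * K) = n - 1"
    using m n K(1) by (subst degree_mult_eq) auto
  moreover have "lead_coeff ([:int n, m:] * K) = m ^ (n - 1)"
  proof -
    have "lead_coeff ([:int n, m:] * K) = m * m ^ (n - 2)"
      unfolding lead_coeff_mult K(2) using m by simp
    also have "\<dots> = m ^ Suc (n - 2)" by simp
    also have "Suc (n - 2) = n - 1" using n by simp
    finally show ?thesis .
  qed
  moreover have "of_int disc * (1 - lam) + lam\<^sup>2 * poly (map_poly of_int K) \<theta> = 0"
  proof -
    let ?y = "of_int m * \<theta>"
    have lam: "?y + of_int (int n) = lam" by (simp add: lam_def m_def)
    have "F = [:int n, 1:] * ([:int n, 1:] * K2 + [:- disc:]) + [:disc:]"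
      using F Q unfolding F0 Q0 by simp
    then have "poly (map_poly of_int F) ?y = poly (map_poly of_int ([:int n, 1:] * ([:int n, 1:] * K2 + [:- disc:]) + [:disc:])) ?y"
      by simp
    also have "\<dots> = lam * (lam * poly (map_poly of_int K2) ?y - of_int disc) + of_int disc"
      unfolding of_int_poly_hom.hom_add of_int_poly_hom.hom_mult poly_add poly_mult ipoly_pCons lam[symmetric]
      by (simp add: algebra_simps)
    also have "poly (map_poly of_int K2) ?y = poly (map_poly of_int K) \<theta>"
      by (simp add: K_def of_int_hom.map_poly_pcompose poly_pcompose ipoly_pCons mult.commute)
    finally have 1: "poly (map_poly of_int F) ?y = lam * (lam * poly (map_poly of_int K) \<theta> - of_int disc) + of_int disc" .
    have "poly (map_poly of_int F) ?y = of_int m ^ n * (\<theta> ^ n + of_int b * (\<theta> + 1))"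
      unfolding F_def pw(2)
      by (simp add: ipoly_pCons of_int_poly_hom.hom_add map_poly_monom poly_monom power_mult_distrib)
         (simp add: pw(2) power_minus_mult n algebra_simps flip: of_int_power)
    also have "\<dots> = 0" using theta_pow by simp
    finally show ?thesis using 1 by (simp add: algebra_simps power2_eq_square)
  qed
  ultimately show ?thesis unfolding m_def by (rule that)
qed

text \<open>Modulo \<open>lam\<close>, the product \<open>(n - 1) * \<theta>\<close> equals
  \<open>-n\<close>. Each power of \<theta> thus reduces to an integer at the price of a factor
  \<open>n - 1\<close>, and \<open>N\<close> counts these factors.\<close>

lemma int_adjoin_mod_lam:
  assumes "x \<in> int_adjoin \<theta>"
  obtains N c \<mu> where "\<mu> \<in> int_adjoin \<theta>" "of_int ((int n - 1) ^ N) * x = of_int c + lam * \<mu>"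
proof -
  obtain P where P: "x = poly (map_poly of_int P) \<theta>" using assms by (auto simp: int_adjoin_def)
  have "\<exists>N c \<mu>. \<mu> \<in> int_adjoin \<theta> \<and> of_int ((int n - 1) ^ N) * poly (map_poly of_int P) \<theta> = of_int c + lam * \<mu>"
  proof (induction P)
    case 0
    show ?case using int_adjoin_int[of 0 \<theta>] by (intro exI[of _ 0] exI[of _ "0 :: int"] exI[of _ "0 :: complex"]) simp
  next
    case (pCons a P)
    define m where "m = int n - 1"
    let ?P = "poly (map_poly of_int P) \<theta> :: complex"
    obtain N c \<mu> where \<mu>: "\<mu> \<in> int_adjoin \<theta>" and eq: "of_int (m ^ N) * ?P = of_int c + lam * \<mu>"
      using pCons.IH unfolding m_def by blast
    have mth: "of_int m * \<theta> = lam - of_int (int n)" by (simp add: lam_def m_def)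
    have "of_int (m ^ Suc N) * poly (map_poly of_int (pCons a P)) \<theta>
        = of_int (m ^ Suc N * a) + (of_int m * \<theta>) * (of_int (m ^ N) * ?P)"
      by (simp add: ipoly_pCons algebra_simps)
    also have "\<dots> = of_int (m ^ Suc N * a - int n * c) + lam * (of_int c + (lam - of_int (int n)) * \<mu>)"
      unfolding eq mth by (simp add: algebra_simps)
    finally have "of_int (m ^ Suc N) * poly (map_poly of_int (pCons a P)) \<theta>
      = of_int (m ^ Suc N * a - int n * c) + lam * (of_int c + (lam - of_int (int n)) * \<mu>)" .
    moreover have "of_int c + (lam - of_int (int n)) * \<mu> \<in> int_adjoin \<theta>"
      by (intro int_adjoin_add int_adjoin_mult int_adjoin_diff int_adjoin_int lam_in \<mu>)
    ultimately show ?case unfolding m_def by blast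
  qed
  with that show ?thesis unfolding P by blast
qed

text \<open>For \<open>w = x / p\<close>, the product \<open>lam * w\<close> already lies in
  \<open>int_adjoin \<theta>\<close>, and \<open>lam_equation\<close> serves to remove
  \<open>lam\<close>. If \<open>p\<close> divides \<open>disc\<close>, the condition on
  \<open>p^2\<close> keeps the cofactor \<open>u\<close> prime to \<open>p\<close>.\<close>

lemma divide_in_int_adjoin_if_not_dvd_coeff:
  assumes p: "prime p" "\<not> p dvd b" "\<not> p\<^sup>2 dvd disc"
    and x: "x \<in> int_adjoin \<theta>" "algebraic_int (x / of_int p)"
  shows "x / of_int p \<in> int_adjoin \<theta>"
proof -
  define m where "m = int n - 1"
  have "p \<noteq> 0" using p by auto
  have cop: "coprime c p" if "\<not> p dvd c" for c
    using prime_imp_coprime[OF p(1) that] by (simp add: coprime_commute)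
  obtain K0 where K0: "degree ([:int n, m:] * K0) = n - 1" "lead_coeff ([:int n, m:] * K0) = m ^ (n - 1)"
    "of_int disc * (1 - lam) + lam\<^sup>2 * poly (map_poly of_int K0) \<theta> = 0"
    using lam_equation unfolding m_def .
  define K :: complex where "K = poly (map_poly of_int K0) \<theta>"
  have Kin: "K \<in> int_adjoin \<theta>" unfolding K_def by (rule int_adjoin_ipoly)
  have eqn: "of_int disc * (1 - lam) = - (lam\<^sup>2 * K)"
    using K0(3) unfolding K_def by (simp add: eq_neg_iff_add_eq_0)
  define w where "w = x / of_int p"
  have lw: "lam * w \<in> int_adjoin \<theta>"
    using lam_times_algebraic_int[OF p(1,2) x] by (simp add: w_def)
  show ?thesis
  proof (cases "p dvd disc")
    case False
    \<comment> \<open>The relation expresses \<open>disc * w\<close> through \<open>lam * w\<close>,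
      and \<open>disc\<close> is invertible modulo \<open>p\<close>.\<close>
    have "of_int disc * w = of_int disc * (1 - lam) * w + of_int disc * (lam * w)"
      by (simp add: algebra_simps)
    also have "\<dots> = of_int disc * (lam * w) - lam * K * (lam * w)"
      unfolding eqn by (simp add: power2_eq_square algebra_simps)
    also have "\<dots> \<in> int_adjoin \<theta>"
      by (intro int_adjoin_diff int_adjoin_mult[OF _ lw] int_adjoin_mult int_adjoin_int lam_in Kin)
    finally show ?thesis
      using int_adjoin_coprime_divide[OF cop[OF False] \<open>p \<noteq> 0\<close> x(1)] by (simp add: w_def)
  next
    case True
    then obtain u where u: "disc = p * u" by (auto elim: dvdE)
    have "\<not> p dvd u" using p(3) \<open>p \<noteq> 0\<close> unfolding u power2_eq_square by simp
    \<comment> \<open>A prime dividing both \<open>m = n - 1\<close> and \<open>disc\<close> would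
      divide \<open>n\<close>.\<close>
    have "\<not> p dvd m"
    proof
      assume "p dvd m"
      then have "p dvd b * m ^ (n - 1)"
        using n by (intro dvd_mult dvd_trans[OF \<open>p dvd m\<close> dvd_power]) simp
      then have "p dvd (- int n) ^ n" using True unfolding disc_def m_def[symmetric]
        by (metis diff_add_cancel dvd_add)
      from prime_dvd_power[OF p(1) this] have "p dvd int n" by simp
      then have "p dvd int n - m" using \<open>p dvd m\<close> by (rule dvd_diff)
      then show False using p(1) not_prime_unit by (auto simp: m_def)
    qed
    have eqn': "of_int u * (1 - lam) = - (lam\<^sup>2 * K) / of_int p"
      using eqn \<open>p \<noteq> 0\<close> unfolding u by (simp add: field_simps)
    obtain N c \<mu> where \<mu>: "\<mu> \<in> int_adjoin \<theta>" and c: "of_int (m ^ N) * (lam * w) = of_int c + lam * \<mu>"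
      using int_adjoin_mod_lam[OF lw] unfolding m_def by blast
    \<comment> \<open>Up to a factor prime to \<open>p\<close> and an element of
      \<open>int_adjoin \<theta>\<close>, this replaces \<open>w\<close> by an element whose product
      with \<open>lam\<close> is an integer.\<close>
    define w' where "w' = of_int (m ^ N) * w - \<mu>"
    have lw': "lam * w' = of_int c" using c by (simp add: w'_def algebra_simps)
    have algw': "algebraic_int w'"
      unfolding w'_def w_def
      by (rule algebraic_int_diff[OF algebraic_int_mult[OF algebraic_int_int x(2)] algebraic_int_int_adjoin[OF \<mu>]])
    have uw': "of_int u * w' = of_int c * of_int u - of_int c * (lam * K) / of_int p"
    proof -
      have "of_int u * w' = of_int u * (1 - lam) * w' + of_int u * (lam * w')" by (simp add: algebra_simps)
      also have "\<dots> = - (lam * w') * (lam * K) / of_int p + of_int u * (lam * w')"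
        unfolding eqn' by (simp add: power2_eq_square)
      finally show ?thesis unfolding lw' by simp
    qed
    show ?thesis
    proof (cases "p dvd c")
      case True
      then obtain c' where c': "c = p * c'" by (auto elim: dvdE)
      have "of_int u * w' = of_int c * of_int u - of_int c' * (lam * K)"
        unfolding uw' c' using \<open>p \<noteq> 0\<close> by simp
      also have "\<dots> \<in> int_adjoin \<theta>"
        by (intro int_adjoin_diff int_adjoin_mult int_adjoin_int lam_in Kin)
      finally have "of_int u * w' + of_int u * \<mu> \<in> int_adjoin \<theta>"
        by (rule int_adjoin_add[OF _ int_adjoin_mult[OF int_adjoin_int \<mu>]])
      then have "of_int (u * m ^ N) * x / of_int p \<in> int_adjoin \<theta>"
        by (simp add: w'_def w_def algebra_simps)
      moreover have "\<not> p dvd u * m ^ N"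
        using \<open>\<not> p dvd u\<close> \<open>\<not> p dvd m\<close> p(1) by (meson prime_dvd_mult_iff prime_dvd_power)
      ultimately show ?thesis
        using int_adjoin_coprime_divide[OF cop \<open>p \<noteq> 0\<close> x(1)] by blast
    next
      case False
      \<comment> \<open>This case is contradictory: it makes \<open>K / p\<close> integral and so
        puts \<open>lam * K / p\<close> into \<open>int_adjoin \<theta>\<close>, although
        \<open>lam * K\<close>, as a polynomial in \<theta>, has the leading coefficient
        \<open>m ^ (n - 1)\<close>, which is prime to \<open>p\<close>.\<close>
      have lK: "lam * K \<in> int_adjoin \<theta>" by (intro int_adjoin_mult lam_in Kin)
      have "of_int c * (lam * K) / of_int p = of_int c * of_int u - of_int u * w'"
        using uw' by simp
      also have "algebraic_int \<dots>"
        by (intro algebraic_int_diff algebraic_int_mult algebraic_int_int algw')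
      finally have v: "algebraic_int (lam * K / of_int p)"
        by (rule algebraic_int_coprime_divide[OF cop[OF False] \<open>p \<noteq> 0\<close> algebraic_int_int_adjoin[OF lK]])
      \<comment> \<open>The square of this integral element is \<open>- u (1 - lam) K / p\<close>.\<close>
      have l1K: "(1 - lam) * K \<in> int_adjoin \<theta>"
        using int_adjoin_int[of 1] by (intro int_adjoin_mult int_adjoin_diff lam_in Kin) simp
      have "of_int u * ((1 - lam) * K) / of_int p = - ((lam * K / of_int p) * (lam * K / of_int p))"
        unfolding mult.assoc[symmetric] eqn' by (simp add: power2_eq_square)
      also have "algebraic_int \<dots>" using algebraic_int_mult[OF v v] by simp
      finally have "algebraic_int ((1 - lam) * K / of_int p)"
        by (rule algebraic_int_coprime_divide[OF cop[OF \<open>\<not> p dvd u\<close>] \<open>p \<noteq> 0\<close> algebraic_int_int_adjoin[OF l1K]])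
      \<comment> \<open>\<open>K\<close> is the sum of \<open>(1 - lam) * K\<close> and
        \<open>lam * K\<close>.\<close>
      from algebraic_int_add[OF this v] have "algebraic_int (K / of_int p)"
        by (simp add: algebra_simps flip: add_divide_distrib)
      from lam_times_algebraic_int[OF p(1,2) Kin this] have "lam * K / of_int p \<in> int_adjoin \<theta>" .
      also have "lam * K = poly (map_poly of_int ([:int n, m:] * K0)) \<theta>"
        unfolding of_int_poly_hom.hom_mult poly_mult ipoly_pCons by (simp add: K_def lam_def m_def algebra_simps)
      finally have div: "poly (map_poly of_int ([:int n, m:] * K0)) \<theta> / of_int p \<in> int_adjoin \<theta>" .
      have "degree ([:int n, m:] * K0) < degree (trinom n b)"
        unfolding K0(1) degree_trinom[OF n] using n by simp
      from dvd_coeff_if_divide_in_int_adjoin[OF lead_coeff_trinom[OF n] irr root this \<open>p \<noteq> 0\<close> div]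
      have "p dvd coeff ([:int n, m:] * K0) (n - 1)" .
      then have "p dvd m ^ (n - 1)" using K0(2) unfolding K0(1) by metis
      with \<open>\<not> p dvd m\<close> p(1) show ?thesis using prime_dvd_power by blast
    qed
  qed
qed

text \<open>An integral element of the field is an element of \<open>int_adjoin \<theta>\<close>
  divided by a positive integer, whose prime factors are stripped one at a time by the two cases for
  \<open>p\<close>.\<close>

lemma monogenic:
  assumes "\<And>p. prime p \<Longrightarrow> \<not> p\<^sup>2 dvd b" "\<And>p. prime p \<Longrightarrow> \<not> p\<^sup>2 dvd disc"
  shows "monogenic_by \<theta>"
proof -
  have local: "x / of_int p \<in> int_adjoin \<theta>"
    if "prime p" "x \<in> int_adjoin \<theta>" "algebraic_int (x / of_int p)" for p :: int and x
    using divide_in_int_adjoin_if_dvd_coeff[OF that(1) _ _ that(2,3)]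
      divide_in_int_adjoin_if_not_dvd_coeff[OF that(1) _ _ that(2,3)] assms that(1) by blast
  have divide: "x \<in> int_adjoin \<theta> \<Longrightarrow> algebraic_int (x / of_nat d) \<Longrightarrow> x / of_nat d \<in> int_adjoin \<theta>"
    if "d > 0" for d :: nat and x
    using that
  proof (induction d arbitrary: x rule: less_induct)
    case (less d)
    show ?case
    proof (cases "d = 1")
      case True
      then show ?thesis using less.prems by simp
    next
      case False
      then obtain q where "prime q" "q dvd d" using prime_factor_nat by blast
      then obtain e where e: "d = q * e" by (auto elim: dvdE)
      have "e > 0" "e < d" "q > 0"
        using \<open>prime q\<close> less.prems e prime_gt_1_nat[of q] by auto
      \<comment> \<open>Multiplying by \<open>q\<close> leaves the smaller denominator
        \<open>e\<close>, to which the induction applies; \<open>local\<close> then divides by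
        \<open>q\<close>.\<close>
      have "algebraic_int (of_int (int q) * (x / of_nat d))"
        by (intro algebraic_int_mult algebraic_int_int less.prems)
      also have "of_int (int q) * (x / of_nat d) = x / of_nat e" using \<open>q > 0\<close> by (simp add: e)
      finally have "x / of_nat e \<in> int_adjoin \<theta>"
        using less.IH[OF \<open>e < d\<close>] less.prems \<open>e > 0\<close> by blast
      moreover have "x / of_nat e / of_int (int q) = x / of_nat d" by (simp add: e mult.commute)
      ultimately show ?thesis using local[of "int q" "x / of_nat e"] less.prems \<open>prime q\<close>
        by (metis prime_nat_int_transfer)
    qed
  qed
  have "z \<in> int_adjoin \<theta>" if z: "z \<in> rat_adjoin \<theta>" "algebraic_int z" for z
  proof -
    obtain g where g: "z = poly (map_poly of_rat g) \<theta>" using z(1) unfolding rat_adjoin_def by blast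
    have "\<exists>d>0. of_nat d * poly (map_poly of_rat g) \<theta> \<in> int_adjoin \<theta>"
    proof (induction g)
      case 0
      show ?case using int_adjoin_int[of 0 \<theta>] by (intro exI[of _ 1]) simp
    next
      case (pCons a g)
      then obtain d where d: "d > 0" "of_nat d * poly (map_poly of_rat g) \<theta> \<in> int_adjoin \<theta>" by blast
      obtain r s where rs: "quotient_of a = (r, s)" by force
      then have "s > 0" and a: "a = of_int r / of_int s"
        using quotient_of_denom_pos quotient_of_div by blast+
      have "of_nat (nat s * d) * poly (map_poly of_rat (pCons a g)) \<theta>
          = of_int (int d * r) + of_int s * \<theta> * (of_nat d * poly (map_poly of_rat g) \<theta>)"
        using \<open>s > 0\<close> by (simp add: of_rat_hom.map_poly_pCons_hom a of_rat_divide algebra_simps)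
      also have "\<dots> \<in> int_adjoin \<theta>"
        by (intro int_adjoin_add int_adjoin_mult[OF _ d(2)] int_adjoin_mult int_adjoin_int int_adjoin_gen)
      finally show ?case using d(1) \<open>s > 0\<close> by (intro exI[of _ "nat s * d"]) simp
    qed
    then obtain d where d: "d > 0" "of_nat d * z \<in> int_adjoin \<theta>" unfolding g by blast
    with divide[of d "of_nat d * z"] z(2) show ?thesis by simp
  qed
  moreover have "z \<in> rat_adjoin \<theta>" if z: "z \<in> int_adjoin \<theta>" for z
  proof -
    obtain P where "z = poly (map_poly of_int P) \<theta>" using z by (auto simp: int_adjoin_def)
    then have "z = poly (map_poly of_rat (map_poly of_int P)) \<theta>" by (simp add: map_poly_of_rat_of_int)
    then show ?thesis unfolding rat_adjoin_def by blast
  qed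
  ultimately show ?thesis
    unfolding monogenic_by_def ring_of_integers_def algebraic_integer_iff
    using algebraic_int_int_adjoin by blast
qed

end

text \<open>Since \<open>b \<ge> 2\<close>, there is a prime divisor of \<open>b\<close>, and
  Eisenstein's criterion applies at it.\<close>

lemma trinom_irreducible:
  assumes "n > 2" "b \<ge> 2" "\<And>p :: int. prime p \<Longrightarrow> \<not> p\<^sup>2 dvd b"
  shows "irreducible (map_poly rat_of_int (trinom n b))"
proof -
  obtain p where p: "prime p" "p dvd b" using prime_divisor_exists[of b] \<open>b \<ge> 2\<close> by auto
  show ?thesis
  proof (rule eisenstein_irreducible[OF lead_coeff_trinom[OF \<open>n > 2\<close>] _ p(1)])
    show "p dvd coeff (trinom n b) i" if "i < degree (trinom n b)" for i
      using that p(2) by (auto simp: coeff_trinom degree_trinom[OF \<open>n > 2\<close>])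
  qed (use assms p in \<open>auto simp: coeff_trinom degree_trinom\<close>)
qed

section \<open>Sieving linear forms by squares of primes\<close>

text \<open>By a finite Euler product, the sum of \<open>1 / n^2\<close> over the positive
  \<open>n\<close> without prime factor in \<open>Q\<close> is \<open>pi^2 / 6\<close> times the
  product. The term \<open>n = 1\<close> alone contributes 1.\<close>

lemma prod_primes_inverse_square_ge:
  assumes "finite Q" "\<And>p. p \<in> Q \<Longrightarrow> prime p"
  shows "(\<Prod>p\<in>Q. 1 - 1 / (real p)\<^sup>2) \<ge> 6 / pi\<^sup>2"
proof -
  define s where "s = (\<lambda>Q n. if n > 0 \<and> (\<forall>p\<in>Q. \<not> p dvd n) then 1 / (real n)\<^sup>2 else 0)"
  have sums: "s Q sums (pi\<^sup>2 / 6 * (\<Prod>p\<in>Q. 1 - 1 / (real p)\<^sup>2))"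
    using assms
  proof (induction Q rule: finite_induct)
    case empty
    have "(\<lambda>n. s {} (Suc n)) sums (pi\<^sup>2 / 6)"
      using inverse_squares_sums by (simp add: s_def add.commute)
    then have "s {} sums (pi\<^sup>2 / 6 + s {} 0)" by (simp only: sums_Suc_iff)
    then show ?case by (simp add: s_def)
  next
    case (insert p Q)
    then have IH: "s Q sums (pi\<^sup>2 / 6 * (\<Prod>p\<in>Q. 1 - 1 / (real p)\<^sup>2))" (is "_ sums ?T") and "prime p"
      by auto
    then have "p > 0" by (simp add: prime_gt_0_nat)
    have "(\<lambda>n. s Q n / (real p)\<^sup>2) sums (?T / (real p)\<^sup>2)"
      by (rule sums_divide[OF IH])
    \<comment> \<open>Adding \<open>p\<close> to \<open>Q\<close> removes just the terms at
      multiples of \<open>p\<close>, and these are the old terms scaled by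
      \<open>1 / p^2\<close>.\<close>
    moreover have "s Q n / (real p)\<^sup>2 = (s Q (n * p) - s (insert p Q) (n * p))" for n
    proof -
      have "q dvd n * p \<longleftrightarrow> q dvd n" if "q \<in> Q" for q
      proof -
        have "prime q" "q \<noteq> p" using insert that by auto
        then have "\<not> q dvd p" using \<open>prime p\<close> primes_dvd_imp_eq by blast
        with \<open>prime q\<close> show ?thesis by (simp add: prime_dvd_mult_iff)
      qed
      then show ?thesis using \<open>p > 0\<close> by (auto simp: s_def power_mult_distrib)
    qed
    ultimately have "(\<lambda>n. s Q (n * p) - s (insert p Q) (n * p)) sums (?T / (real p)\<^sup>2)"
      by simp
    then have "(\<lambda>n. s Q n - s (insert p Q) n) sums (?T / (real p)\<^sup>2)"
    proof (subst (asm) sums_mono_reindex[of "\<lambda>n. n * p"])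
      show "strict_mono (\<lambda>n. n * p)" using \<open>p > 0\<close> by (simp add: strict_mono_def)
      show "s Q n - s (insert p Q) n = 0" if "n \<notin> range (\<lambda>n. n * p)" for n
      proof -
        have "\<not> p dvd n" using that by (metis dvd_div_mult_self rangeI)
        then show ?thesis by (simp add: s_def)
      qed
    qed
    from sums_diff[OF IH this] have "s (insert p Q) sums (?T - ?T / (real p)\<^sup>2)"
      by simp
    then show ?case using insert by (simp add: algebra_simps)
  qed
  have "sum (s Q) {1} \<le> suminf (s Q)"
    by (rule sum_le_suminf) (use sums in \<open>auto simp: s_def sums_iff\<close>)
  moreover have "s Q 1 = 1" using assms(2)[of 1] by (auto simp: s_def)
  ultimately have "1 \<le> pi\<^sup>2 / 6 * (\<Prod>p\<in>Q. 1 - 1 / (real p)\<^sup>2)"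
    using sums by (simp add: sums_iff)
  then show ?thesis by (simp add: field_simps)
qed

text \<open>The members of the class are \<open>r + d * k\<close> with \<open>k\<close> between a
  ceiling and a floor, and the two roundings together cost at most 1.\<close>

lemma card_cong_interval_bounds:
  fixes r d :: int and N :: nat
  assumes "d > 0"
  shows "\<bar>real (card {b \<in> {1..int N}. [b = r] (mod d)}) - real N / of_int d\<bar> \<le> 1"
proof -
  have "{b \<in> {1..int N}. [b = r] (mod d)} = (\<lambda>k. r + d * k) ` {k. 1 \<le> r + d * k \<and> r + d * k \<le> int N}"
  proof -
    have "[b = r] (mod d) \<longleftrightarrow> (\<exists>k. b = r + d * k)" for b
      using cong_iff_lin[of r b d] cong_sym_eq[of b r d] by simp
    then show ?thesis by auto
  qed
  also have "{k. 1 \<le> r + d * k \<and> r + d * k \<le> int N} = {\<lceil>(1 - r) / d\<rceil>..\<lfloor>(N - r) / d\<rfloor>}"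
  proof -
    have "1 \<le> r + d * k \<longleftrightarrow> \<lceil>(1 - r) / d\<rceil> \<le> k" for k
    proof -
      have "\<lceil>(1 - r) / d\<rceil> \<le> k \<longleftrightarrow> (1 - real_of_int r) \<le> k * real_of_int d"
        using assms by (simp add: ceiling_le_iff divide_le_eq)
      also have "\<dots> \<longleftrightarrow> real_of_int (1 - r) \<le> real_of_int (k * d)" by simp
      also have "\<dots> \<longleftrightarrow> 1 \<le> r + d * k" by (subst of_int_le_iff) (auto simp: algebra_simps)
      finally show ?thesis by simp
    qed
    moreover have "r + d * k \<le> int N \<longleftrightarrow> k \<le> \<lfloor>(N - r) / d\<rfloor>" for k
    proof -
      have "k \<le> \<lfloor>(N - r) / d\<rfloor> \<longleftrightarrow> k * real_of_int d \<le> real_of_int (int N) - real_of_int r"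
        using assms by (simp add: le_floor_iff le_divide_eq)
      also have "\<dots> \<longleftrightarrow> real_of_int (k * d) \<le> real_of_int (int N - r)" by simp
      also have "\<dots> \<longleftrightarrow> r + d * k \<le> int N" by (subst of_int_le_iff) (auto simp: algebra_simps)
      finally show ?thesis by simp
    qed
    ultimately show ?thesis by auto
  qed
  also have "card ((\<lambda>k. r + d * k) ` \<dots>) = card \<dots>"
    using assms by (intro card_image) (auto simp: inj_on_def)
  also have "\<dots> = nat (\<lfloor>(N - r) / d\<rfloor> - \<lceil>(1 - r) / d\<rceil> + 1)" by simp
  finally have *: "card {b \<in> {1..int N}. [b = r] (mod d)} = nat (\<lfloor>(N - r) / d\<rfloor> - \<lceil>(1 - r) / d\<rceil> + 1)" .
  \<comment> \<open>This keeps the argument of \<open>nat\<close> nonnegative even if the interval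
    misses the class. It is also sharper by \<open>1 / d\<close> than the general bound for a
    ceiling, which the final estimate relies on.\<close>
  have c1: "\<lceil>real_of_int (1 - r) / d\<rceil> \<le> \<lfloor>(0 - real_of_int r) / d\<rfloor> + 1"
  proof (rule ceiling_le)
    define t where "t = \<lfloor>(0 - real_of_int r) / d\<rfloor>"
    have "(0 - real_of_int r) / d < real_of_int t + 1" unfolding t_def by linarith
    then have "real_of_int (- r) < real_of_int ((t + 1) * d)" using assms by (simp add: field_simps)
    then have "- r < (t + 1) * d" by (simp only: of_int_less_iff)
    then have "1 - r \<le> (t + 1) * d" by simp
    then have "real_of_int (1 - r) \<le> real_of_int ((t + 1) * d)" by (simp only: of_int_le_iff)
    then show "real_of_int (1 - r) / real_of_int d \<le> real_of_int (t + 1)"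
      using assms by (simp add: divide_le_eq)
  qed
  have ge: "\<lceil>(1 - r) / d\<rceil> \<le> \<lfloor>(N - r) / d\<rfloor> + 1"
  proof -
    note c1
    also have "\<dots> \<le> \<lfloor>(N - real_of_int r) / d\<rfloor> + 1"
      using assms by (intro add_right_mono floor_mono divide_right_mono) auto
    finally show ?thesis by simp
  qed
  have "real (card {b \<in> {1..int N}. [b = r] (mod d)}) = of_int \<lfloor>(N - r) / d\<rfloor> - of_int \<lceil>(1 - r) / d\<rceil> + 1"
    unfolding * using ge by simp
  moreover have "of_int \<lfloor>(N - r) / d\<rfloor> \<le> (N - r) / d" "of_int \<lfloor>(N - r) / d\<rfloor> > (N - r) / d - 1"
     "of_int \<lceil>(1 - r) / d\<rceil> \<ge> (1 - r) / d" "of_int \<lceil>(1 - r) / d\<rceil> \<le> (0 - real_of_int r) / d + 1"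
    using c1 by linarith+
  moreover have "(N - r) / d = N / d - r / d" "(1 - r) / d = 1 / d - r / d" "(0 - real_of_int r) / d = - (r / d)"
    by (simp_all add: diff_divide_distrib)
  moreover have "0 < 1 / real_of_int d" "1 / real_of_int d \<le> 1" using assms by auto
  ultimately show ?thesis by linarith
qed

lemma cong_interval_density:
  fixes r d :: int
  assumes "d > 0"
  shows "(\<lambda>N. real (card {b \<in> {1..int N}. [b = r] (mod d)}) / real N) \<longlonglongrightarrow> 1 / real_of_int d"
proof (rule LIM_zero_cancel, rule Lim_null_comparison)
  show "\<forall>\<^sub>F N in sequentially. norm (real (card {b \<in> {1..int N}. [b = r] (mod d)}) / real N - 1 / real_of_int d) \<le> 1 / real N"
    using eventually_gt_at_top[of 0]
  proof eventually_elim
    case (elim N)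
    have "norm (real (card {b \<in> {1..int N}. [b = r] (mod d)}) / real N - 1 / real_of_int d)
        = \<bar>(real (card {b \<in> {1..int N}. [b = r] (mod d)}) - real N / real_of_int d) / real N\<bar>"
      using elim by (simp add: diff_divide_distrib)
    also have "\<dots> \<le> 1 / real N"
      unfolding abs_divide using card_cong_interval_bounds[OF assms, of N r] elim
      by (simp add: divide_right_mono)
    finally show ?case .
  qed
  show "(\<lambda>N. 1 / real N) \<longlonglongrightarrow> 0" by (rule lim_1_over_n)
qed

text \<open>A prime dividing both \<open>m\<close> and the value would divide \<open>c\<close>. So
  only primes not dividing \<open>m\<close> have to be sieved.\<close>

lemma square_dvd_linear_imp_not_dvd:
  fixes c m :: int
  assumes "coprime c m" "prime p" "(int p)\<^sup>2 dvd c + m * b"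
  shows "\<not> int p dvd m"
proof
  assume "int p dvd m"
  moreover have "int p dvd c + m * b" using assms(3) by (meson dvd_power dvd_trans pos2)
  ultimately have "int p dvd c" by (metis dvd_add_left_iff dvd_mult2)
  with \<open>int p dvd m\<close> \<open>coprime c m\<close> have "is_unit (int p)" by (meson coprime_common_divisor)
  with \<open>prime p\<close> show False by simp
qed

text \<open>\<open>m\<close> is invertible modulo \<open>p^2\<close>, so the condition singles out
  one residue class.\<close>

lemma square_dvd_linear_iff_cong:
  fixes c m :: int
  assumes "coprime c m" "prime p" "\<not> int p dvd m"
  obtains s where "\<And>b. (int p)\<^sup>2 dvd c + m * b \<longleftrightarrow> [b = s] (mod (int p)\<^sup>2)"
proof -
  have cop: "coprime m ((int p)\<^sup>2)"
    using assms prime_imp_coprime[of "int p" m] by (simp add: coprime_commute)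
  then obtain u where u: "[m * u = 1] (mod (int p)\<^sup>2)"
    using cong_solve_coprime_int by blast
  have "(int p)\<^sup>2 dvd c + m * b \<longleftrightarrow> [b = - c * u] (mod (int p)\<^sup>2)" for b
  proof -
    have "[m * (- c * u) = - c] (mod (int p)\<^sup>2)"
      using cong_scalar_left[OF u, of "- c"] by (simp add: mult_ac)
    then have "[m * b = m * (- c * u)] (mod (int p)\<^sup>2) \<longleftrightarrow> [m * b = - c] (mod (int p)\<^sup>2)"
      using cong_sym cong_trans by blast
    also have "\<dots> \<longleftrightarrow> (int p)\<^sup>2 dvd c + m * b"
      by (simp add: cong_iff_dvd_diff add.commute)
    finally show ?thesis using cong_mult_lcancel[OF cop, of b "- c * u"] by simp
  qed
  then show ?thesis by (rule that)
qed

text \<open>The class of \<open>r\<close> modulo \<open>d\<close> is carried along for the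
  induction: by the Chinese remainder theorem, a further prime \<open>q\<close> removes the part of
  the sieved set in one class modulo \<open>d * q^2\<close>, whose density the induction hypothesis
  also gives.\<close>

lemma sieve_density:
  fixes c m :: int
  assumes cm: "coprime c m" and "finite Q"
    and "\<And>p. p \<in> Q \<Longrightarrow> prime p" "\<And>p. p \<in> Q \<Longrightarrow> \<not> int p dvd m" "\<And>p. p \<in> Q \<Longrightarrow> coprime (int p) d" "d > 0"
  shows "(\<lambda>N. real (card {b \<in> {1..int N}. [b = r] (mod d) \<and> (\<forall>p\<in>Q. \<not> (int p)\<^sup>2 dvd c + m * b)}) / real N)
           \<longlonglongrightarrow> (\<Prod>p\<in>Q. 1 - 1 / (real p)\<^sup>2) / real_of_int d"
  using assms(2-)
proof (induction Q arbitrary: r d rule: finite_induct)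
  case empty
  then show ?case using cong_interval_density[of d r] by simp
next
  case (insert q Q)
  let ?A = "\<lambda>r d N. {b \<in> {1..int N}. [b = r] (mod d) \<and> (\<forall>p\<in>Q. \<not> (int p)\<^sup>2 dvd c + m * b)}"
  have "prime q" "\<not> int q dvd m" "coprime (int q) d" "q > 0"
    using insert.prems by (auto simp: prime_gt_0_nat)
  obtain s where s: "\<And>b. (int q)\<^sup>2 dvd c + m * b \<longleftrightarrow> [b = s] (mod (int q)\<^sup>2)"
    using square_dvd_linear_iff_cong[OF cm \<open>prime q\<close> \<open>\<not> int q dvd m\<close>] by blast
  have cop: "coprime d ((int q)\<^sup>2)"
    using \<open>coprime (int q) d\<close> by (simp add: coprime_commute)
  obtain t where t: "[t = r] (mod d)" "[t = s] (mod (int q)\<^sup>2)"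
    using binary_chinese_remainder_int[OF cop] by blast
  have split: "?A r d N - {b. (int q)\<^sup>2 dvd c + m * b} = ?A r d N - ?A t (d * (int q)\<^sup>2) N"
    and sub: "?A t (d * (int q)\<^sup>2) N \<subseteq> ?A r d N" for N
  proof -
    have "[b = t] (mod d * (int q)\<^sup>2) \<longleftrightarrow> [b = r] (mod d) \<and> [b = s] (mod (int q)\<^sup>2)" for b
    proof -
      have "[b = t] (mod d * (int q)\<^sup>2) \<longleftrightarrow> [b = t] (mod d) \<and> [b = t] (mod (int q)\<^sup>2)"
        using coprime_cong_mult[OF _ _ cop] cong_modulus_mult cong_modulus_mult[of b t "(int q)\<^sup>2" d]
        by (metis mult.commute)
      then show ?thesis using t cong_sym cong_trans by blast
    qed
    then show "?A r d N - {b. (int q)\<^sup>2 dvd c + m * b} = ?A r d N - ?A t (d * (int q)\<^sup>2) N"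
      "?A t (d * (int q)\<^sup>2) N \<subseteq> ?A r d N"
      using s by auto
  qed
  have eq: "{b \<in> {1..int N}. [b = r] (mod d) \<and> (\<forall>p\<in>insert q Q. \<not> (int p)\<^sup>2 dvd c + m * b)}
      = ?A r d N - ?A t (d * (int q)\<^sup>2) N" for N
    unfolding split[symmetric] by auto
  have fin: "finite (?A r d N)" for r d N by (rule finite_subset[of _ "{1..int N}"]) auto
  have "real (card (?A r d N - ?A t (d * (int q)\<^sup>2) N)) / real N
      = real (card (?A r d N)) / real N - real (card (?A t (d * (int q)\<^sup>2) N)) / real N" for N
    using card_Diff_subset[OF fin sub] card_mono[OF fin sub, of N] by (simp add: of_nat_diff diff_divide_distrib)
  moreover have "(\<lambda>N. real (card (?A r d N)) / real N - real (card (?A t (d * (int q)\<^sup>2) N)) / real N)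
     \<longlonglongrightarrow> (\<Prod>p\<in>Q. 1 - 1 / (real p)\<^sup>2) / real_of_int d - (\<Prod>p\<in>Q. 1 - 1 / (real p)\<^sup>2) / real_of_int (d * (int q)\<^sup>2)"
  proof (intro tendsto_diff insert.IH)
    fix p assume "p \<in> Q"
    then have "prime p" "p \<noteq> q" using insert by auto
    then have "coprime p q" using \<open>prime q\<close> primes_coprime by blast
    then have "coprime (int p) (int q)" by simp
    with \<open>p \<in> Q\<close> insert.prems show "coprime (int p) (d * (int q)\<^sup>2)" by simp
  qed (use insert.prems \<open>q > 0\<close> in auto)
  ultimately have "(\<lambda>N. real (card (?A r d N - ?A t (d * (int q)\<^sup>2) N)) / real N)
     \<longlonglongrightarrow> (\<Prod>p\<in>Q. 1 - 1 / (real p)\<^sup>2) / real_of_int d - (\<Prod>p\<in>Q. 1 - 1 / (real p)\<^sup>2) / real_of_int (d * (int q)\<^sup>2)"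
    by (simp only:)
  moreover have "(\<Prod>p\<in>insert q Q. 1 - 1 / (real p)\<^sup>2) / real_of_int d =
     (\<Prod>p\<in>Q. 1 - 1 / (real p)\<^sup>2) / real_of_int d - (\<Prod>p\<in>Q. 1 - 1 / (real p)\<^sup>2) / real_of_int (d * (int q)\<^sup>2)"
    using insert.hyps by (simp add: algebra_simps diff_divide_distrib)
  ultimately show ?case unfolding eq by (simp only:)
qed

text \<open>Telescoping, with \<open>1 / k^2\<close> at most
  \<open>1 / (k - 1) - 1 / k\<close>.\<close>

lemma sum_inverse_squares_le:
  assumes "P \<ge> 1"
  shows "(\<Sum>k\<in>{P<..B}. 1 / (real k)\<^sup>2) \<le> 1 / real P"
proof (cases "P \<le> B")
  case True
  have "(\<Sum>k\<in>{P<..B}. 1 / (real k)\<^sup>2) \<le> 1 / real P - 1 / real B"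
    using True
  proof (induction B rule: dec_induct)
    case (step B)
    have "{P<..Suc B} = insert (Suc B) {P<..B}" using step by auto
    then have "(\<Sum>k\<in>{P<..Suc B}. 1 / (real k)\<^sup>2) = 1 / (real (Suc B))\<^sup>2 + (\<Sum>k\<in>{P<..B}. 1 / (real k)\<^sup>2)"
      by simp
    also have "\<dots> \<le> 1 / (real (Suc B))\<^sup>2 + (1 / real P - 1 / real B)"
      using step by simp
    also have "1 / (real (Suc B))\<^sup>2 \<le> 1 / (real B * real (Suc B))"
      using step assms by (intro divide_left_mono) (auto simp: power2_eq_square)
    also have "1 / (real B * real (Suc B)) = 1 / real B - 1 / real (Suc B)"
      using step assms by (simp add: field_simps)
    finally show ?case by simp
  qed auto
  then show ?thesis by (smt (verit) divide_nonneg_nonneg of_nat_0_le_iff)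
qed auto

text \<open>If the value is not 0, then \<open>p\<close> is at most the square root of a bound for
  the values. Each such prime accounts for at most \<open>N / p^2 + 1\<close> integers: the first
  parts sum to at most \<open>N / P\<close>, the ones to at most the square root. The last 1 covers
  a zero of the linear form.\<close>

lemma square_sieve_tail:
  fixes c m :: int and N P :: nat
  assumes cm: "coprime c m" "m \<noteq> 0" and "P \<ge> 1"
  shows "real (card {b \<in> {1..int N}. \<exists>p>P. prime p \<and> (int p)\<^sup>2 dvd c + m * b})
     \<le> real N / real P + sqrt (of_int (\<bar>c\<bar> + \<bar>m\<bar> * int N)) + 1"
proof -
  define B where "B = nat \<lfloor>sqrt (of_int (\<bar>c\<bar> + \<bar>m\<bar> * int N))\<rfloor>"
  define Q where "Q = {p \<in> {P<..B}. prime p \<and> \<not> int p dvd m}"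
  let ?E = "\<lambda>p. {b \<in> {1..int N}. (int p)\<^sup>2 dvd c + m * b}"
  let ?Z = "{b. c + m * b = 0}"
  have Z: "card ?Z \<le> 1" "finite ?Z"
  proof -
    have "?Z \<subseteq> {- c div m}"
      using cm by (auto simp: eq_neg_iff_add_eq_0[symmetric])
    then show "card ?Z \<le> 1" "finite ?Z" using card_mono[of "{- c div m}" ?Z] finite_subset by auto
  qed
  have "{b \<in> {1..int N}. \<exists>p>P. prime p \<and> (int p)\<^sup>2 dvd c + m * b} \<subseteq> ?Z \<union> (\<Union>p\<in>Q. ?E p)"
  proof
    fix b assume "b \<in> {b \<in> {1..int N}. \<exists>p>P. prime p \<and> (int p)\<^sup>2 dvd c + m * b}"
    then obtain p where b: "b \<in> {1..int N}" and p: "p > P" "prime p" "(int p)\<^sup>2 dvd c + m * b" by auto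
    have "b \<in> (\<Union>p\<in>Q. ?E p)" if "c + m * b \<noteq> 0"
    proof -
      have "(int p)\<^sup>2 \<le> \<bar>c + m * b\<bar>"
        using dvd_imp_le_int[OF that p(3)] by simp
      also have "\<dots> \<le> \<bar>c\<bar> + \<bar>m * b\<bar>" by (rule abs_triangle_ineq)
      also have "\<bar>m * b\<bar> \<le> \<bar>m\<bar> * int N"
        unfolding abs_mult using b by (intro mult_left_mono) auto
      finally have "(int p)\<^sup>2 \<le> \<bar>c\<bar> + \<bar>m\<bar> * int N" by simp
      then have "real_of_int ((int p)\<^sup>2) \<le> of_int (\<bar>c\<bar> + \<bar>m\<bar> * int N)" by (simp only: of_int_le_iff)
      then have "real p \<le> sqrt (of_int (\<bar>c\<bar> + \<bar>m\<bar> * int N))" by (intro real_le_rsqrt) simp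
      then have "p \<le> B" unfolding B_def by (simp add: le_nat_floor)
      moreover have "\<not> int p dvd m"
        by (rule square_dvd_linear_imp_not_dvd[OF cm(1) p(2,3)])
      ultimately show ?thesis using p b by (auto simp: Q_def)
    qed
    then show "b \<in> ?Z \<union> (\<Union>p\<in>Q. ?E p)" by blast
  qed
  moreover have finQ: "finite Q" by (auto simp: Q_def)
  ultimately have "card {b \<in> {1..int N}. \<exists>p>P. prime p \<and> (int p)\<^sup>2 dvd c + m * b} \<le> card (?Z \<union> (\<Union>p\<in>Q. ?E p))"
    using Z by (intro card_mono finite_UnI finite_UN_I) (auto intro: finite_subset[of _ "{1..int N}"])
  also have "\<dots> \<le> card ?Z + card (\<Union>p\<in>Q. ?E p)" by (rule card_Un_le)
  also have "\<dots> \<le> 1 + (\<Sum>p\<in>Q. card (?E p))" using Z card_UN_le[OF finQ, of ?E] by linarith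
  finally have "real (card {b \<in> {1..int N}. \<exists>p>P. prime p \<and> (int p)\<^sup>2 dvd c + m * b}) \<le> 1 + (\<Sum>p\<in>Q. real (card (?E p)))"
    by (simp flip: of_nat_sum)
  also have "(\<Sum>p\<in>Q. real (card (?E p))) \<le> (\<Sum>p\<in>Q. real N * (1 / (real p)\<^sup>2) + 1)"
  proof (rule sum_mono)
    fix p assume "p \<in> Q"
    then have p: "prime p" "\<not> int p dvd m" by (auto simp: Q_def)
    obtain s where s: "\<And>b. (int p)\<^sup>2 dvd c + m * b \<longleftrightarrow> [b = s] (mod (int p)\<^sup>2)"
      using square_dvd_linear_iff_cong[OF cm(1) p] by blast
    have "(int p)\<^sup>2 > 0" using p prime_gt_0_nat by auto
    from card_cong_interval_bounds[OF this, of N s] show "real (card (?E p)) \<le> real N * (1 / (real p)\<^sup>2) + 1"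
      unfolding s by simp
  qed
  also have "\<dots> \<le> (\<Sum>p\<in>{P<..B}. real N * (1 / (real p)\<^sup>2) + 1)"
    by (intro sum_mono2) (auto simp: Q_def)
  also have "\<dots> = real N * (\<Sum>p\<in>{P<..B}. 1 / (real p)\<^sup>2) + real (B - P)"
    by (simp add: sum.distrib sum_distrib_left)
  also have "\<dots> \<le> real N * (1 / real P) + sqrt (of_int (\<bar>c\<bar> + \<bar>m\<bar> * int N))"
  proof (intro add_mono mult_left_mono sum_inverse_squares_le)
    have "real B \<le> sqrt (of_int (\<bar>c\<bar> + \<bar>m\<bar> * int N))" unfolding B_def by (simp add: of_nat_floor)
    then show "real (B - P) \<le> sqrt (of_int (\<bar>c\<bar> + \<bar>m\<bar> * int N))" by linarith
  qed (use \<open>P \<ge> 1\<close> in auto)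
  finally show ?thesis by simp
qed

text \<open>Primes up to \<open>P\<close> are handled by the exact density of the finite sieve,
  larger ones by \<open>square_sieve_tail\<close>. The errors from the limit, from
  \<open>N / P\<close> and from the square root take \<open>\<epsilon> / 3\<close> each.\<close>

lemma nonsquarefree_density_upper:
  fixes c m :: int and \<epsilon> :: real
  assumes cm: "coprime c m" "m \<noteq> 0" and "\<epsilon> > 0"
  defines "\<delta> \<equiv> 6 / pi\<^sup>2 * (\<Prod>p\<in>{p. prime p \<and> int p dvd m}. inverse (1 - 1 / (real p)\<^sup>2))"
  shows "\<forall>\<^sub>F N in sequentially.
     real (card {b \<in> {1..int N}. \<exists>p. prime p \<and> (int p)\<^sup>2 dvd c + m * b}) \<le> (1 - \<delta> + \<epsilon>) * real N"
proof -
  obtain P0 :: nat where P0: "3 / \<epsilon> < real P0" using reals_Archimedean2 by blast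
  \<comment> \<open>The bound \<open>P0\<close> makes the tail \<open>N / P\<close> small, and
    taking \<open>P\<close> at least \<open>nat \<bar>m\<bar>\<close> places all prime divisors of
    \<open>m\<close> below \<open>P\<close>.\<close>
  define P where "P = max P0 (max 1 (nat \<bar>m\<bar>))"
  have P: "P \<ge> 1" "nat \<bar>m\<bar> \<le> P" "3 / \<epsilon> < real P" using P0 by (auto simp: P_def)
  have invP: "1 / real P < \<epsilon> / 3" using P \<open>\<epsilon> > 0\<close> by (simp add: field_simps)
  define Q where "Q = {p \<in> {..P}. prime p \<and> \<not> int p dvd m}"
  define D where "D = {p. prime p \<and> int p dvd m}"
  have "D \<subseteq> {..P}"
  proof
    fix p assume "p \<in> D"
    then have "\<bar>int p\<bar> \<le> \<bar>m\<bar>" by (intro dvd_imp_le_int[OF \<open>m \<noteq> 0\<close>]) (simp add: D_def)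
    with P(2) show "p \<in> {..P}" by simp
  qed
  then have fin: "finite D" "finite Q" by (auto simp: Q_def intro: finite_subset)
  have pos: "1 - 1 / (real p)\<^sup>2 > 0" if "prime p" for p
    using prime_gt_1_nat[OF that] by (simp add: power2_eq_square less_1_mult)
  have \<delta>: "\<delta> \<le> (\<Prod>p\<in>Q. 1 - 1 / (real p)\<^sup>2)"
  proof -
    \<comment> \<open>The primes dividing \<open>m\<close> are joined to \<open>Q\<close> for the
      Euler product bound and divided out afterwards, which yields the inverse factors of
      \<delta>.\<close>
    have "6 / pi\<^sup>2 \<le> (\<Prod>p\<in>Q \<union> D. 1 - 1 / (real p)\<^sup>2)"
      by (rule prod_primes_inverse_square_ge) (use fin in \<open>auto simp: Q_def D_def\<close>)
    also have "\<dots> = (\<Prod>p\<in>Q. 1 - 1 / (real p)\<^sup>2) * (\<Prod>p\<in>D. 1 - 1 / (real p)\<^sup>2)"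
      by (rule prod.union_disjoint) (use fin in \<open>auto simp: Q_def D_def\<close>)
    finally have *: "6 / pi\<^sup>2 \<le> (\<Prod>p\<in>Q. 1 - 1 / (real p)\<^sup>2) * (\<Prod>p\<in>D. 1 - 1 / (real p)\<^sup>2)" .
    have "(\<Prod>p\<in>D. 1 - 1 / (real p)\<^sup>2) > 0"
      by (intro prod_pos ballI pos) (simp add: D_def)
    then have "6 / pi\<^sup>2 / (\<Prod>p\<in>D. 1 - 1 / (real p)\<^sup>2) \<le> (\<Prod>p\<in>Q. 1 - 1 / (real p)\<^sup>2)"
      using * by (simp add: pos_divide_le_eq mult_ac)
    moreover have "\<delta> = 6 / pi\<^sup>2 / (\<Prod>p\<in>D. 1 - 1 / (real p)\<^sup>2)"
      unfolding \<delta>_def D_def[symmetric] using prod_inversef[of "\<lambda>p. 1 - 1 / (real p)\<^sup>2" D]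
      by (simp add: comp_def divide_inverse)
    ultimately show ?thesis by simp
  qed
  let ?A = "\<lambda>N. {b \<in> {1..int N}. \<forall>p\<in>Q. \<not> (int p)\<^sup>2 dvd c + m * b}"
  let ?T = "\<lambda>N. {b \<in> {1..int N}. \<exists>p>P. prime p \<and> (int p)\<^sup>2 dvd c + m * b}"
  have "(\<lambda>N. real (card (?A N)) / real N) \<longlonglongrightarrow> (\<Prod>p\<in>Q. 1 - 1 / (real p)\<^sup>2)"
  proof -
    \<comment> \<open>Modulus 1 imposes no congruence.\<close>
    have "(\<lambda>N. real (card {b \<in> {1..int N}. [b = 0] (mod 1) \<and> (\<forall>p\<in>Q. \<not> (int p)\<^sup>2 dvd c + m * b)}) / real N)
        \<longlonglongrightarrow> (\<Prod>p\<in>Q. 1 - 1 / (real p)\<^sup>2) / real_of_int 1"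
      by (rule sieve_density[OF cm(1) fin(2)]) (simp_all add: Q_def)
    then show ?thesis by (simp add: cong_def)
  qed
  then have ev1: "\<forall>\<^sub>F N in sequentially. real (card (?A N)) / real N > (\<Prod>p\<in>Q. 1 - 1 / (real p)\<^sup>2) - \<epsilon> / 3"
    using \<open>\<epsilon> > 0\<close> by (intro order_tendstoD) auto
  have "(\<lambda>N. (sqrt (a + e * real N) + 1) / real N) \<longlonglongrightarrow> 0" if "e > 0" for a e :: real
    using that by real_asymp
  from this[of "of_int \<bar>m\<bar>" "of_int \<bar>c\<bar>"] have ev2: "\<forall>\<^sub>F N in sequentially. (sqrt (of_int \<bar>c\<bar> + of_int \<bar>m\<bar> * real N) + 1) / real N < \<epsilon> / 3"
    using \<open>\<epsilon> > 0\<close> \<open>m \<noteq> 0\<close> by (intro order_tendstoD) auto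
  show ?thesis
    using ev1 ev2 eventually_gt_at_top[of 0]
  proof eventually_elim
    case (elim N)
    have "{b \<in> {1..int N}. \<exists>p. prime p \<and> (int p)\<^sup>2 dvd c + m * b} \<subseteq> ({1..int N} - ?A N) \<union> ?T N"
    proof
      fix b assume "b \<in> {b \<in> {1..int N}. \<exists>p. prime p \<and> (int p)\<^sup>2 dvd c + m * b}"
      then obtain p where b: "b \<in> {1..int N}" and p: "prime p" "(int p)\<^sup>2 dvd c + m * b" by auto
      have "\<not> int p dvd m"
        by (rule square_dvd_linear_imp_not_dvd[OF cm(1) p])
      then show "b \<in> ({1..int N} - ?A N) \<union> ?T N" using b p by (cases "p \<le> P") (auto simp: Q_def)
    qed
    then have "card {b \<in> {1..int N}. \<exists>p. prime p \<and> (int p)\<^sup>2 dvd c + m * b} \<le> card (({1..int N} - ?A N) \<union> ?T N)"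
      by (rule card_mono[rotated]) (rule finite_subset[of _ "{1..int N}"], auto)
    also have "\<dots> \<le> card ({1..int N} - ?A N) + card (?T N)" by (rule card_Un_le)
    also have "card ({1..int N} - ?A N) = N - card (?A N)"
      by (subst card_Diff_subset, rule finite_subset[of _ "{1..int N}"]) auto
    finally have "real (card {b \<in> {1..int N}. \<exists>p. prime p \<and> (int p)\<^sup>2 dvd c + m * b})
       \<le> real (N - card (?A N)) + real (card (?T N))" by (simp flip: of_nat_add)
    also have "real (N - card (?A N)) = real N - real (card (?A N))"
    proof -
      have "card (?A N) \<le> card {1..int N}" by (intro card_mono) auto
      then show ?thesis by simp
    qed
    also have "real (card (?T N)) \<le> real N / real P + sqrt (of_int (\<bar>c\<bar> + \<bar>m\<bar> * int N)) + 1"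
      by (rule square_sieve_tail[OF cm P(1)])
    finally have *: "real (card {b \<in> {1..int N}. \<exists>p. prime p \<and> (int p)\<^sup>2 dvd c + m * b})
       \<le> real N - real (card (?A N)) + (real N / real P + sqrt (of_int \<bar>c\<bar> + of_int \<bar>m\<bar> * real N) + 1)"
      by simp
    have "(\<Prod>p\<in>Q. 1 - 1 / (real p)\<^sup>2) * real N - \<epsilon> / 3 * real N < real (card (?A N))"
      using elim by (simp add: less_divide_eq left_diff_distrib)
    moreover have "\<delta> * real N \<le> (\<Prod>p\<in>Q. 1 - 1 / (real p)\<^sup>2) * real N"
      using \<delta> by (intro mult_right_mono) auto
    moreover have "sqrt (of_int \<bar>c\<bar> + of_int \<bar>m\<bar> * real N) + 1 < \<epsilon> / 3 * real N"
      using elim by (simp add: divide_less_eq)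
    moreover have "real N / real P \<le> \<epsilon> / 3 * real N"
      using mult_right_mono[OF less_imp_le[OF invP], of "real N"] by simp
    moreover have "(1 - \<delta> + \<epsilon>) * real N = real N - \<delta> * real N + \<epsilon> * real N" by (simp add: algebra_simps)
    ultimately show ?case using * by linarith
  qed
qed

section \<open>Density of monogenic trinomials\<close>

lemma no_prime_square_dvd_int:
  fixes p a :: int
  assumes "\<nexists>q :: nat. prime q \<and> (int q)\<^sup>2 dvd a" "prime p"
  shows "\<not> p\<^sup>2 dvd a"
  using assms by (metis int_nat_eq prime_ge_0_int prime_int_nat_transfer)

lemma trinom_irreducible_monogenic:
  fixes n :: nat and b :: int
  assumes "n > 2" "b \<ge> 2" "\<nexists>p. prime p \<and> (int p)\<^sup>2 dvd b"
    and "\<nexists>p. prime p \<and> (int p)\<^sup>2 dvd (- int n) ^ n - b * (int n - 1) ^ (n - 1)"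
  shows "irreducible (map_poly rat_of_int (trinom n b))"
    and "poly (map_poly of_int (trinom n b)) \<theta> = 0 \<Longrightarrow> monogenic_by \<theta>"
proof -
  note sq = no_prime_square_dvd_int[OF assms(3)] no_prime_square_dvd_int[OF assms(4)]
  show irr: "irreducible (map_poly rat_of_int (trinom n b))"
    using trinom_irreducible[OF assms(1,2)] sq(1) by blast
  assume "poly (map_poly of_int (trinom n b)) \<theta> = 0"
  then interpret trinom_root n b \<theta>
    using irr assms(1) by unfold_locales
  show "monogenic_by \<theta>"
    by (rule monogenic) (use sq in \<open>auto simp: disc_def\<close>)
qed

lemma lower_density_geI:
  assumes "\<And>\<epsilon>. \<epsilon> > 0 \<Longrightarrow> \<forall>\<^sub>F N in sequentially.
     (\<alpha> - \<epsilon>) * real N \<le> real (card {b \<in> A. 1 \<le> b \<and> b \<le> int N})"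
  shows "lower_density A \<ge> ereal \<alpha>"
proof (rule ereal_le_epsilon2)
  fix \<epsilon> :: real assume "\<epsilon> > 0"
  have "ereal (\<alpha> - \<epsilon>) \<le> lower_density A"
    unfolding lower_density_def
  proof (rule Liminf_bounded)
    show "\<forall>\<^sub>F N in sequentially. ereal (\<alpha> - \<epsilon>) \<le> ereal (real (card {b \<in> A. 1 \<le> b \<and> b \<le> int N}) / real N)"
      using assms[OF \<open>\<epsilon> > 0\<close>] eventually_gt_at_top[of 0]
      by eventually_elim (simp add: pos_le_divide_eq)
  qed
  from add_right_mono[OF this, of "ereal \<epsilon>"] show "ereal \<alpha> \<le> lower_density A + ereal \<epsilon>" by simp
qed

text \<open>For a finite set the counts stay bounded, so their quotients by \<open>N\<close> tend to
  0.\<close>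

lemma infinite_if_lower_density_pos:
  assumes "lower_density A > 0"
  shows "infinite A"
proof
  assume fin: "finite A"
  have "(\<lambda>N. real (card {b \<in> A. 1 \<le> b \<and> b \<le> int N}) / real N) \<longlonglongrightarrow> 0"
  proof (rule tendsto_sandwich[OF _ _ tendsto_const])
    show "(\<lambda>N. real (card A) / real N) \<longlonglongrightarrow> 0"
      by (rule lim_const_over_n)
    show "\<forall>\<^sub>F N in sequentially. real (card {b \<in> A. 1 \<le> b \<and> b \<le> int N}) / real N \<le> real (card A) / real N"
      using fin by (intro always_eventually allI divide_right_mono) (auto intro: card_mono)
  qed simp
  then have "(\<lambda>N. ereal (real (card {b \<in> A. 1 \<le> b \<and> b \<le> int N}) / real N)) \<longlonglongrightarrow> 0"
    by (simp add: zero_ereal_def)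
  then have "lower_density A = 0"
    unfolding lower_density_def by (intro lim_imp_Liminf) auto
  with assms show False by simp
qed

theorem theorem3p5:
  fixes n :: nat
  assumes "n > 2"
  defines "S \<equiv> {b :: int. irreducible (map_poly (of_int :: int \<Rightarrow> rat) (trinom n b)) \<and>
                 (\<forall>\<theta> :: complex. poly (map_poly of_int (trinom n b)) \<theta> = 0 \<longrightarrow> monogenic_by \<theta>)}"
  defines "\<alpha> \<equiv> 6 / pi\<^sup>2 - (1 - 6 / pi\<^sup>2 *
                 (\<Prod>p\<in>{p :: nat. prime p \<and> p dvd (n - 1)}. inverse (1 - 1 / (real p)\<^sup>2)))"
  shows "infinite S \<and> lower_density S \<ge> ereal \<alpha> \<and> \<alpha> > 0.2158"
proof -
  define D where "D = {p :: nat. prime p \<and> p dvd (n - 1)}"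
  \<comment> \<open>With these, \<open>c + m * b\<close> is the factor \<open>disc\<close> of the
    discriminant. Up to sign they are powers of consecutive integers, hence coprime.\<close>
  define c m where "c = (- int n) ^ n" and "m = - ((int n - 1) ^ (n - 1))"
  \<comment> \<open>\<open>bad 0 1\<close> concerns the square divisors of \<open>b\<close> itself,
    \<open>bad c m\<close> those of \<open>disc\<close>.\<close>
  define bad :: "int \<Rightarrow> int \<Rightarrow> int set" where "bad = (\<lambda>c m. {b. \<exists>p. prime p \<and> (int p)\<^sup>2 dvd c + m * b})"
  have cm: "coprime c m" "m \<noteq> 0"
  proof -
    show "coprime c m" unfolding c_def m_def by simp
    show "m \<noteq> 0" unfolding m_def using assms(1) by simp
  qed
  have D: "{p. prime p \<and> int p dvd m} = D"
  proof -
    have "int p dvd m \<longleftrightarrow> p dvd n - 1" if "prime p" for p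
    proof -
      have "int n - 1 = int (n - 1)" using assms(1) by simp
      then have "m = - int ((n - 1) ^ (n - 1))"
        unfolding m_def by (simp only: of_nat_power)
      then have "int p dvd m \<longleftrightarrow> p dvd (n - 1) ^ (n - 1)"
        by (simp only: dvd_minus_iff int_dvd_int_iff)
      also have "\<dots> \<longleftrightarrow> p dvd n - 1"
        using that assms(1) by (simp add: prime_dvd_power_iff)
      finally show ?thesis .
    qed
    then show ?thesis unfolding D_def by blast
  qed
  have good: "b \<in> S" if "b \<ge> 2" "b \<notin> bad 0 1" "b \<notin> bad c m" for b
  proof -
    have b: "\<nexists>p. prime p \<and> (int p)\<^sup>2 dvd b" "\<nexists>p. prime p \<and> (int p)\<^sup>2 dvd (- int n) ^ n - b * (int n - 1) ^ (n - 1)"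
      using that(2,3) by (auto simp: bad_def c_def m_def mult.commute)
    show ?thesis
      unfolding S_def using trinom_irreducible_monogenic[OF assms(1) \<open>b \<ge> 2\<close> b] by blast
  qed
  define \<delta> where "\<delta> = 6 / pi\<^sup>2 * (\<Prod>p\<in>D. inverse (1 - 1 / (real p)\<^sup>2))"
  have \<alpha>: "\<alpha> = 6 / pi\<^sup>2 - (1 - \<delta>)" unfolding \<alpha>_def \<delta>_def D_def ..
  have dens: "lower_density S \<ge> ereal \<alpha>"
  proof (rule lower_density_geI)
    fix \<epsilon> :: real assume "\<epsilon> > 0"
    then have "\<epsilon> / 3 > 0" by simp
    have "(\<lambda>N. 1 / real N) \<longlonglongrightarrow> 0" by (rule lim_1_over_n)
    then have ev: "\<forall>\<^sub>F N in sequentially. 1 / real N < \<epsilon> / 3"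
      using \<open>\<epsilon> / 3 > 0\<close> by (rule order_tendstoD)
    have ev1: "\<forall>\<^sub>F N in sequentially. real (card {b \<in> {1..int N}. b \<in> bad 0 1}) \<le> (1 - 6 / pi\<^sup>2 + \<epsilon> / 3) * real N"
    proof -
      \<comment> \<open>For the form \<open>b\<close> the coefficient is 1, so the product of
        inverse factors is empty.\<close>
      have "{p :: nat. prime p \<and> int p dvd 1} = {}" by auto
      then show ?thesis
        using nonsquarefree_density_upper[of 0 1, OF _ _ \<open>\<epsilon> / 3 > 0\<close>] by (simp only: bad_def) simp
    qed
    have ev2: "\<forall>\<^sub>F N in sequentially. real (card {b \<in> {1..int N}. b \<in> bad c m}) \<le> (1 - \<delta> + \<epsilon> / 3) * real N"
      using nonsquarefree_density_upper[OF cm \<open>\<epsilon> / 3 > 0\<close>] by (simp add: bad_def D \<delta>_def)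
    show "\<forall>\<^sub>F N in sequentially. (\<alpha> - \<epsilon>) * real N \<le> real (card {b \<in> S. 1 \<le> b \<and> b \<le> int N})"
      using ev ev1 ev2 eventually_gt_at_top[of 0]
    proof eventually_elim
      case (elim N)
      let ?G = "{b \<in> S. 1 \<le> b \<and> b \<le> int N}"
      let ?B1 = "{b \<in> {1..int N}. b \<in> bad 0 1}" and ?B2 = "{b \<in> {1..int N}. b \<in> bad c m}"
      have fin: "finite ?G" "finite ?B1" "finite ?B2"
        by (rule finite_subset[of _ "{1..int N}"]; auto)+
      \<comment> \<open>The value \<open>b = 1\<close> is outside the range of \<open>good\<close>
        and is counted apart; the last third of \<epsilon> absorbs it.\<close>
      have "b \<in> {1} \<union> ?G \<union> ?B1 \<union> ?B2" if "b \<in> {1..int N}" for b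
        using that good[of b] by (cases "b = 1") auto
      then have "{1..int N} \<subseteq> {1} \<union> ?G \<union> ?B1 \<union> ?B2" by blast
      then have "card {1..int N} \<le> card ({1} \<union> ?G \<union> ?B1 \<union> ?B2)"
        by (rule card_mono[rotated]) (use fin in blast)
      also have "\<dots> \<le> card ({1} \<union> ?G \<union> ?B1) + card ?B2" by (rule card_Un_le)
      also have "card ({1} \<union> ?G \<union> ?B1) \<le> card ({1} \<union> ?G) + card ?B1" by (rule card_Un_le)
      also have "card ({1} \<union> ?G) \<le> card {1 :: int} + card ?G" by (rule card_Un_le)
      finally have "N \<le> 1 + card ?G + card ?B1 + card ?B2" by simp
      then have "real N \<le> real (1 + card ?G + card ?B1 + card ?B2)" by (simp only: of_nat_le_iff)
      then have "real N \<le> 1 + real (card ?G) + real (card ?B1) + real (card ?B2)" by simp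
      then have *: "real N - real (card ?B1) - real (card ?B2) - 1 \<le> real (card ?G)" by linarith
      have "1 < \<epsilon> / 3 * real N" using elim by (simp add: divide_less_eq)
      have "(\<alpha> - \<epsilon>) * real N = real N - (1 - 6 / pi\<^sup>2 + \<epsilon> / 3) * real N
          - (1 - \<delta> + \<epsilon> / 3) * real N - \<epsilon> / 3 * real N"
        unfolding \<alpha> by (simp add: algebra_simps)
      also have "\<dots> \<le> real N - real (card ?B1) - real (card ?B2) - 1"
        using elim(2,3) \<open>1 < \<epsilon> / 3 * real N\<close> by (intro diff_mono) simp_all
      also note *
      finally show ?case .
    qed
  qed
  have num: "\<alpha> > 0.2158"
  proof -
    \<comment> \<open>As every factor is at least 1, \<alpha> is at least
      \<open>12 / pi^2 - 1\<close> for every \<open>n\<close>, and \<open>pi \<le> 3.1416\<close>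
      suffices for the stated digits.\<close>
    have "1 \<le> (\<Prod>p\<in>D. inverse (1 - 1 / (real p)\<^sup>2))"
    proof (rule prod_ge_1)
      fix p assume "p \<in> D"
      then have "real p > 1" using prime_gt_1_nat by (auto simp: D_def)
      then have "1 / (real p)\<^sup>2 < 1" by (simp add: power2_eq_square less_1_mult)
      moreover have "1 / (real p)\<^sup>2 \<ge> 0" by simp
      ultimately show "1 \<le> inverse (1 - 1 / (real p)\<^sup>2)" by (intro one_le_inverse) linarith+
    qed
    then have "6 / pi\<^sup>2 \<le> \<delta>" unfolding \<delta>_def by (simp add: mult_left_le[of _ 1] field_simps)
    moreover have "pi\<^sup>2 \<le> 3.1416\<^sup>2" using pi_approx by (intro power_mono) auto
    then have "6 / pi\<^sup>2 \<ge> 6 / 3.1416\<^sup>2" by (intro divide_left_mono) auto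
    moreover have "2 * (6 / 3.1416\<^sup>2) > (1 + 0.2158 :: real)" by (simp add: power2_eq_square)
    ultimately show ?thesis unfolding \<alpha> by linarith
  qed
  have "lower_density S > 0"
  proof -
    have "ereal \<alpha> > 0" using num by simp
    then show ?thesis using dens by (rule less_le_trans)
  qed
  then show ?thesis using dens num infinite_if_lower_density_pos by blast
qed

end
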